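(* Let $d=2$. Let $O_-\subset D_0\subset\mathbb{R}^2$ be open sets with $D_0$ bounded. Let $\{D_t\}_{t\ge0}$ be the open evolution of $V=-\kappa$ (i.e. $\nu=0$) with initial set $D_0$ and obstacles $O_-$ and $O_+=\mathbb{R}^2$, and let $\{E_t\}_{t\ge0}$ be the closed evolution of $V=-\kappa$ with initial set $E_0=\overline{D_0}$ and obstacles $C_-=\overline{O_-}$ and $C_+=\mathbb{R}^2$. Define a graph $G=(V,E)$ by $$V:=\{O\subset\mathbb{R}^2\mid O\text{ is a connected component of }O_-\},$$ $$E:=\{\langle O,P\rangle\mid O,P\in V\text{ and } l_{x,y}\subset D_0\text{ for some }x\in O\text{ and }y\in P\}.$$ Assume that the graph $G$ is connected. Then $$Co(O_-)\subset\varliminf_{t\to\infty}D_t\subset\varlimsup_{t\to\infty}D_t\subset\overline{Co(O_-)}$$ and $$Co(O_-)\subset\varliminf_{t\to\infty}E_t\subset\varlimsup_{t\to\infty}E_t\subset\overline{Co(O_-)}.$$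
   Context: Notation: $l_{x,y}$ is the line segment with endpoints $x,y$; $Co(A)$ is the convex hull of $A$; $\langle\cdot,\cdot\rangle$ (in $E$) denotes an unordered pair. A graph is a pair $(V,E)$ with $V$ nonempty and $E$ a set of unordered pairs in $V$; it is connected if any $v_1,v_2\in V$ are the endpoints of a path, i.e. there are finitely many $x_0=v_1,x_1,\dots,x_n=v_2$ in $V$ (repetitions permitted) with $\langle x_i,x_{i+1}\rangle\in E$. For a family of sets, $\varlimsup_{t\to\infty}D_t:=\bigcap_{\tau>0}\bigcup_{t>\tau}D_t$ and $\varliminf_{t\to\infty}D_t:=\bigcup_{\tau>0}\bigcap_{t>\tau}D_t$. Let $\mathbb{S}^d$ be the real symmetric $d\times d$ matrices, and $F(p,X)=-\mathrm{Tr}\big((I-\frac{p\otimes p}{|p|^2})X\big)$ for $p\in\mathbb{R}^d\setminus\{0\}$, $X\in\mathbb{S}^d$. Upper and lower stars denote upper and lower semicontinuous envelopes. For $\nu\in\mathbb{R}$, Lipschitz functions $\Psi_-\le\Psi_+$ on $\mathbb{R}^d$ and $u_0\in C(\mathbb{R}^d)$, consider the obstacle problem (P): $u_t-\nu|Du|+F(Du,D^2u)=0$ in $\mathbb{R}^d\times(0,\infty)$, $u(\cdot,0)=u_0$, $\Psi_-(x)\le u(x,t)\le\Psi_+(x)$ in $\mathbb{R}^d\times(0,\infty)$. $u$ is a viscosity subsolution of (P) if (a) $\Psi_-(x)\le u^*(x,t)\le\Psi_+(x)$ for all $(x,t)\in\mathbb{R}^d\times(0,\infty)$; (b) $u^*(x,0)\le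 u_0(x)$ for all $x$; (c) whenever $\phi$ is smooth, $u^*-\phi$ has a local maximum at $(x_0,t_0)\in\mathbb{R}^d\times(0,\infty)$ and $u^*(x_0,t_0)>\Psi_-(x_0)$, one has $\phi_t-\nu|D\phi|+F_*(D\phi,D^2\phi)\le0$ at $(x_0,t_0)$. $u$ is a viscosity supersolution if (a) $\Psi_-(x)\le u_*(x,t)\le\Psi_+(x)$ for all $(x,t)\in\mathbb{R}^d\times(0,\infty)$; (b) $u_*(x,0)\ge u_0(x)$ for all $x$; (c) whenever $\phi$ is smooth, $u_*-\phi$ has a local minimum at $(x_0,t_0)\in\mathbb{R}^d\times(0,\infty)$ and $u_*(x_0,t_0)<\Psi_+(x_0)$, one has $\phi_t-\nu|D\phi|+F^*(D\phi,D^2\phi)\ge0$ at $(x_0,t_0)$. A viscosity solution is both. For a constant $a<0$ let $K_a(\mathbb{R}^d\times[0,\infty))$ be the set of $u\in C(\mathbb{R}^d\times[0,\infty))$ such that for all $T>0$ there is $R>0$ with $u=a$ on $\{|x|\ge R\}\times[0,T]$. Open evolution: for open sets $D_0,O_-,O_+$, a family of open sets $\{D_t\}_{t\ge0}$ is the open evolution of $V=-\kappa+\nu$ with initial set $D_0$ and obstacles $O_-,O_+$ ($O_-\subset D_t\subset O_+$) if there exist Lipschitz $\Psi_\pm$, $u_0\in C(\mathbb{R}^d)$ and a viscosity solution $u\in K_a(\mathbb{R}^d\times[0,\infty))$ of (P) such that $O_\pm=\{\Psi_\pm>0\}$ and $D_t=\{x\mid u(x,t)>0\}$ for all $t\ge0$.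 Closed evolution: for closed sets $E_0,C_-,C_+$, the family of closed sets $\{E_t\}_{t\ge0}$ is defined in the same way with $C_\pm=\{\Psi_\pm\ge0\}$ and $E_t=\{x\mid u(x,t)\ge0\}$ for all $t\ge0$. Open and closed evolutions exist and are unique (known result). *)

theory Defs
  imports "HOL-Analysis.Analysis" "HOL-Library.Uprod"
begin

section \<open>Semicontinuous envelopes\<close>

text \<open>The envelopes are those of \<open>f\<close> restricted to \<open>S\<close> and are meaningful at all points of
  the closure of \<open>S\<close>. The balls are not punctured. Values are extended reals because no local
  boundedness of \<open>f\<close> is assumed.\<close>

definition usc_env :: "'a::metric_space set \<Rightarrow> ('a \<Rightarrow> real) \<Rightarrow> 'a \<Rightarrow> ereal" where
  "usc_env S f z = (INF r\<in>{0<..}. SUP y\<in>S \<inter> ball z r. ereal (f y))"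

definition lsc_env :: "'a::metric_space set \<Rightarrow> ('a \<Rightarrow> real) \<Rightarrow> 'a \<Rightarrow> ereal" where
  "lsc_env S f z = (SUP r\<in>{0<..}. INF y\<in>S \<inter> ball z r. ereal (f y))"

section \<open>Smooth functions and their derivatives\<close>

definition dir_deriv :: "('a::real_normed_vector \<Rightarrow> real) \<Rightarrow> 'a \<Rightarrow> 'a \<Rightarrow> real" where
  "dir_deriv f v z = frechet_derivative f (at z) v"

text \<open>For open \<open>S\<close> in a Euclidean space, \<open>Ck_on k f S\<close> says that \<open>f\<close> is of class
  \<open>C\<^sup>k\<close> on \<open>S\<close>.\<close>

primrec Ck_on :: "nat \<Rightarrow> ('a::euclidean_space \<Rightarrow> real) \<Rightarrow> 'a set \<Rightarrow> bool" where
  "Ck_on 0 f S \<longleftrightarrow> continuous_on S f"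
| "Ck_on (Suc k) f S \<longleftrightarrow>
     (\<forall>z\<in>S. f differentiable (at z)) \<and> (\<forall>v. Ck_on k (dir_deriv f v) S)"

definition smooth_on :: "('a::euclidean_space \<Rightarrow> real) \<Rightarrow> 'a set \<Rightarrow> bool" where
  "smooth_on f S \<longleftrightarrow> (\<forall>k. Ck_on k f S)"

definition time_deriv :: "((real^'d) \<times> real \<Rightarrow> real) \<Rightarrow> (real^'d) \<times> real \<Rightarrow> real" where
  "time_deriv \<phi> z = dir_deriv \<phi> (0, 1) z"

definition space_grad :: "((real^'d) \<times> real \<Rightarrow> real) \<Rightarrow> (real^'d) \<times> real \<Rightarrow> real^'d" where
  "space_grad \<phi> z = (\<chi> i. dir_deriv \<phi> (axis i 1, 0) z)"

definition space_hess :: "((real^'d) \<times> real \<Rightarrow> real) \<Rightarrow> (real^'d) \<times> real \<Rightarrow> real^'d^'d" where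
  "space_hess \<phi> z = (\<chi> i j. dir_deriv (dir_deriv \<phi> (axis j 1, 0)) (axis i 1, 0) z)"

section \<open>The obstacle problem for the level set equation\<close>

definition tensor :: "real^'d \<Rightarrow> real^'d \<Rightarrow> real^'d^'d" where
  "tensor p q = (\<chi> i j. p $ i * q $ j)"

definition mcf_op :: "(real^'d) \<times> (real^'d^'d) \<Rightarrow> real" where
  "mcf_op = (\<lambda>(p, X). - trace ((mat 1 - (1 / (norm p)\<^sup>2) *\<^sub>R tensor p p) ** X))"

definition mcf_dom :: "((real^'d) \<times> (real^'d^'d)) set" where
  "mcf_dom = {(p, X). p \<noteq> 0 \<and> transpose X = X}"

abbreviation mcf_upper :: "(real^'d) \<times> (real^'d^'d) \<Rightarrow> ereal" where
  "mcf_upper \<equiv> usc_env mcf_dom mcf_op"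

abbreviation mcf_lower :: "(real^'d) \<times> (real^'d^'d) \<Rightarrow> ereal" where
  "mcf_lower \<equiv> lsc_env mcf_dom mcf_op"

definition spacetime :: "((real^'d) \<times> real) set" where
  "spacetime = UNIV \<times> {0..}"

definition spacetime_pos :: "((real^'d) \<times> real) set" where
  "spacetime_pos = UNIV \<times> {0<..}"

definition viscosity_subsolution ::
  "real \<Rightarrow> (real^'d \<Rightarrow> real) \<Rightarrow> (real^'d \<Rightarrow> real) \<Rightarrow> (real^'d \<Rightarrow> real)
    \<Rightarrow> ((real^'d) \<times> real \<Rightarrow> real) \<Rightarrow> bool" where
  "viscosity_subsolution \<nu> \<Psi>m \<Psi>p u0 u \<longleftrightarrow>
    (\<forall>x. \<forall>t>0. ereal (\<Psi>m x) \<le> usc_env spacetime u (x, t) \<and>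
                usc_env spacetime u (x, t) \<le> ereal (\<Psi>p x)) \<and>
    (\<forall>x. usc_env spacetime u (x, 0) \<le> ereal (u0 x)) \<and>
    (\<forall>\<phi> x0 t0.
       smooth_on \<phi> spacetime_pos \<and> t0 > 0 \<and>
       (\<forall>\<^sub>F z in nhds (x0, t0). usc_env spacetime u z - ereal (\<phi> z)
            \<le> usc_env spacetime u (x0, t0) - ereal (\<phi> (x0, t0))) \<and>
       usc_env spacetime u (x0, t0) > ereal (\<Psi>m x0) \<longrightarrow>
       ereal (time_deriv \<phi> (x0, t0) - \<nu> * norm (space_grad \<phi> (x0, t0)))
         + mcf_lower (space_grad \<phi> (x0, t0), space_hess \<phi> (x0, t0)) \<le> 0)"

definition viscosity_supersolution ::
  "real \<Rightarrow> (real^'d \<Rightarrow> real) \<Rightarrow> (real^'d \<Rightarrow> real) \<Rightarrow> (real^'d \<Rightarrow> real)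
    \<Rightarrow> ((real^'d) \<times> real \<Rightarrow> real) \<Rightarrow> bool" where
  "viscosity_supersolution \<nu> \<Psi>m \<Psi>p u0 u \<longleftrightarrow>
    (\<forall>x. \<forall>t>0. ereal (\<Psi>m x) \<le> lsc_env spacetime u (x, t) \<and>
                lsc_env spacetime u (x, t) \<le> ereal (\<Psi>p x)) \<and>
    (\<forall>x. lsc_env spacetime u (x, 0) \<ge> ereal (u0 x)) \<and>
    (\<forall>\<phi> x0 t0.
       smooth_on \<phi> spacetime_pos \<and> t0 > 0 \<and>
       (\<forall>\<^sub>F z in nhds (x0, t0). lsc_env spacetime u z - ereal (\<phi> z)
            \<ge> lsc_env spacetime u (x0, t0) - ereal (\<phi> (x0, t0))) \<and>
       lsc_env spacetime u (x0, t0) < ereal (\<Psi>p x0) \<longrightarrow>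
       ereal (time_deriv \<phi> (x0, t0) - \<nu> * norm (space_grad \<phi> (x0, t0)))
         + mcf_upper (space_grad \<phi> (x0, t0), space_hess \<phi> (x0, t0)) \<ge> 0)"

definition viscosity_solution ::
  "real \<Rightarrow> (real^'d \<Rightarrow> real) \<Rightarrow> (real^'d \<Rightarrow> real) \<Rightarrow> (real^'d \<Rightarrow> real)
    \<Rightarrow> ((real^'d) \<times> real \<Rightarrow> real) \<Rightarrow> bool" where
  "viscosity_solution \<nu> \<Psi>m \<Psi>p u0 u \<longleftrightarrow>
     viscosity_subsolution \<nu> \<Psi>m \<Psi>p u0 u \<and> viscosity_supersolution \<nu> \<Psi>m \<Psi>p u0 u"

definition K_class :: "real \<Rightarrow> ((real^'d) \<times> real \<Rightarrow> real) set" where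
  "K_class a = {u. continuous_on spacetime u \<and>
             (\<forall>T>0. \<exists>R>0. \<forall>x t. norm x \<ge> R \<and> 0 \<le> t \<and> t \<le> T \<longrightarrow> u (x, t) = a)}"

text \<open>The data shared by the open and the closed evolution: admissible obstacle functions and
  initial datum together with a viscosity solution in \<open>K_class a\<close> for some constant \<open>a < 0\<close>.\<close>

definition obstacle_solution ::
  "real \<Rightarrow> (real^'d \<Rightarrow> real) \<Rightarrow> (real^'d \<Rightarrow> real) \<Rightarrow> (real^'d \<Rightarrow> real)
    \<Rightarrow> ((real^'d) \<times> real \<Rightarrow> real) \<Rightarrow> bool" where
  "obstacle_solution \<nu> \<Psi>m \<Psi>p u0 u \<longleftrightarrow>
     (\<exists>L. L-lipschitz_on UNIV \<Psi>m) \<and> (\<exists>L. L-lipschitz_on UNIV \<Psi>p) \<and> (\<forall>x. \<Psi>m x \<le> \<Psi>p x) \<and>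
     continuous_on UNIV u0 \<and> (\<exists>a<0. u \<in> K_class a) \<and> viscosity_solution \<nu> \<Psi>m \<Psi>p u0 u"

section \<open>Open and closed evolutions\<close>

text \<open>Families are indexed by all reals, but only their members with \<open>t \<ge> 0\<close> are constrained.\<close>

definition open_evolution ::
  "real \<Rightarrow> (real^'d) set \<Rightarrow> (real^'d) set \<Rightarrow> (real^'d) set \<Rightarrow> (real \<Rightarrow> (real^'d) set) \<Rightarrow> bool" where
  "open_evolution \<nu> D0 Om Op D \<longleftrightarrow>
     open D0 \<and> open Om \<and> open Op \<and> D 0 = D0 \<and>
     (\<forall>t\<ge>0. open (D t) \<and> Om \<subseteq> D t \<and> D t \<subseteq> Op) \<and>
     (\<exists>\<Psi>m \<Psi>p u0 u. obstacle_solution \<nu> \<Psi>m \<Psi>p u0 u \<and>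
        Om = {x. \<Psi>m x > 0} \<and> Op = {x. \<Psi>p x > 0} \<and>
        (\<forall>t\<ge>0. D t = {x. u (x, t) > 0}))"

definition closed_evolution ::
  "real \<Rightarrow> (real^'d) set \<Rightarrow> (real^'d) set \<Rightarrow> (real^'d) set \<Rightarrow> (real \<Rightarrow> (real^'d) set) \<Rightarrow> bool" where
  "closed_evolution \<nu> E0 Cm Cp E \<longleftrightarrow>
     closed E0 \<and> closed Cm \<and> closed Cp \<and> E 0 = E0 \<and>
     (\<forall>t\<ge>0. closed (E t) \<and> Cm \<subseteq> E t \<and> E t \<subseteq> Cp) \<and>
     (\<exists>\<Psi>m \<Psi>p u0 u. obstacle_solution \<nu> \<Psi>m \<Psi>p u0 u \<and>
        Cm = {x. \<Psi>m x \<ge> 0} \<and> Cp = {x. \<Psi>p x \<ge> 0} \<and>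
        (\<forall>t\<ge>0. E t = {x. u (x, t) \<ge> 0}))"

definition lower_limit :: "(real \<Rightarrow> 'a set) \<Rightarrow> 'a set" where
  "lower_limit D = (\<Union>\<tau>\<in>{0<..}. \<Inter>t\<in>{\<tau><..}. D t)"

definition upper_limit :: "(real \<Rightarrow> 'a set) \<Rightarrow> 'a set" where
  "upper_limit D = (\<Inter>\<tau>\<in>{0<..}. \<Union>t\<in>{\<tau><..}. D t)"

section \<open>Graphs\<close>

text \<open>Loops are allowed, and the vertex set must not be empty.\<close>

definition is_graph :: "'v set \<times> 'v uprod set \<Rightarrow> bool" where
  "is_graph = (\<lambda>(V, E). V \<noteq> {} \<and> (\<forall>e\<in>E. set_uprod e \<subseteq> V))"

definition connected_graph :: "'v set \<times> 'v uprod set \<Rightarrow> bool" where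
  "connected_graph = (\<lambda>(V, E). is_graph (V, E) \<and>
     (\<forall>v\<in>V. \<forall>w\<in>V. \<exists>n (x :: nat \<Rightarrow> 'v). x 0 = v \<and> x n = w \<and> (\<forall>i\<le>n. x i \<in> V) \<and>
        (\<forall>i<n. Upair (x i) (x (Suc i)) \<in> E)))"

definition component_graph ::
  "'a::euclidean_space set \<Rightarrow> 'a set \<Rightarrow> 'a set set \<times> 'a set uprod set" where
  "component_graph Om D0 =
     (components Om,
      {Upair A B | A B. A \<in> components Om \<and> B \<in> components Om \<and>
                        (\<exists>x\<in>A. \<exists>y\<in>B. closed_segment x y \<subseteq> D0)})"

end

theory Submission
  imports Defs
begin

text \<open>Both inclusions come from one barrier: a circle shrinking by its own curvature. In the plane
\<open>h (|x - c|\<^sup>2 + 2 t)\<close> solves the level set equation for every smooth monotone \<open>h\<close>, and a solution \<open>u\<close> that sees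
no obstacle outside a disc cannot stay positive there: choosing for \<open>h\<close> a steep exponential, the
maximum principle (\<open>curvature_comparison\<close>) pushes the positive set into the shrinking disc until
that disc has reached its limit radius (\<open>subflow_confined_to_disc\<close>).

Upper bound. A point outside the closed hull of the obstacle is separated from it by a disc, and
the whole evolution starts in a larger concentric disc. That disc shrinks to the
smaller one, so the point is uncovered from some time on (\<open>upper_limit_subset_hull\<close>).

Lower bound. The same barrier is applied to \<open>-u\<close>, that is, to the complement of the evolution.
First, a segment that joins two points of \<open>Om\<close> inside \<open>D0\<close> is covered for ever: a thin straight
strip around it has uncurved sides and its ends are held by the obstacle (\<open>segment_persists\<close>; the
barrier is a fourth power of the distance from the line, so that both derivatives vanish on the
line itself). The union \<open>S\<close> of these segments is open, and it is connected because the graph is.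
Now let \<open>p\<close> be in the hull of \<open>S\<close> but not in \<open>S\<close>. As \<open>S\<close> is connected, \<open>p\<close> lies between two
points of \<open>S\<close> (\<open>connected_hull_two_points\<close>). Two huge discs that almost touch \<open>p\<close>, one on either side
of the line through these points, enclose \<open>p\<close> together with a compact connected part \<open>A\<close> of \<open>S\<close>; by
Janiszewski's theorem \<open>A\<close> and one of the two discs already do so (\<open>enclosed_by_disc\<close>). In the
bounded component of \<open>p\<close> the complement of the evolution cannot cross \<open>A\<close> and is in contact
with the rest of the plane only through the disc: it is driven back by the shrinking circle, and \<open>p\<close> is covered from some time on
(\<open>hull_point_reached\<close>).

The open and the closed evolution are treated together: they are the sets where \<open>u\<close> takes values
in \<open>{0<..}\<close> and in \<open>{0..}\<close> respectively (\<open>level_range\<close>).\<close>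

section \<open>Smooth test functions\<close>

text \<open>The barriers are built from coordinates by sums, products and exponentials. This class is closed
under directional derivatives, so its members are smooth.\<close>

inductive elementary :: "('a::euclidean_space \<Rightarrow> real) \<Rightarrow> bool" where
  const: "elementary (\<lambda>z. k)"
| linear: "elementary (\<lambda>z. z \<bullet> a)"
| add: "elementary f \<Longrightarrow> elementary g \<Longrightarrow> elementary (\<lambda>z. f z + g z)"
| mult: "elementary f \<Longrightarrow> elementary g \<Longrightarrow> elementary (\<lambda>z. f z * g z)"
| exp: "elementary f \<Longrightarrow> elementary (\<lambda>z. exp (f z))"

lemma dir_deriv_eqI: "(f has_derivative f') (at z) \<Longrightarrow> dir_deriv f v z = f' v"
  unfolding dir_deriv_def by (simp add: frechet_derivative_at [symmetric])

lemma elementary_dir_deriv: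
  assumes "elementary f"
  shows "(\<forall>z. f differentiable (at z)) \<and> (\<forall>v. elementary (dir_deriv f v))"
  using assms
proof (induction rule: elementary.induct)
  case (const k)
  have "dir_deriv (\<lambda>z::'a. k) v = (\<lambda>z. 0)" for v
    by (rule ext, rule dir_deriv_eqI[where f'="\<lambda>_. 0", simplified]) auto
  then show ?case by (auto intro: elementary.const)
next
  case (linear a)
  have D: "((\<lambda>z. z \<bullet> a) has_derivative (\<lambda>v. v \<bullet> a)) (at z)" for z
    by (auto intro!: derivative_eq_intros)
  have "dir_deriv (\<lambda>z. z \<bullet> a) v = (\<lambda>z. v \<bullet> a)" for v
    using dir_deriv_eqI[OF D] by auto
  then show ?case using D by (auto intro: elementary.const differentiableI)
next
  case (add f g)
  have D: "((\<lambda>z. f z + g z) has_derivative (\<lambda>v. dir_deriv f v z + dir_deriv g v z)) (at z)" for z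
    using add.IH unfolding dir_deriv_def
    by (auto intro!: derivative_eq_intros simp: frechet_derivative_works[symmetric])
  have "dir_deriv (\<lambda>z. f z + g z) v = (\<lambda>z. dir_deriv f v z + dir_deriv g v z)" for v
    using dir_deriv_eqI[OF D] by auto
  moreover have "elementary (\<lambda>z. dir_deriv f v z + dir_deriv g v z)" for v
    by (intro elementary.add) (use add in auto)
  ultimately show ?case using D differentiableI by simp blast
next
  case (mult f g)
  have D: "((\<lambda>z. f z * g z) has_derivative
      (\<lambda>v. f z * dir_deriv g v z + dir_deriv f v z * g z)) (at z)" for z
    using mult.IH unfolding dir_deriv_def
    by (auto intro!: derivative_eq_intros simp: frechet_derivative_works[symmetric])
  have "dir_deriv (\<lambda>z. f z * g z) v = (\<lambda>z. f z * dir_deriv g v z + dir_deriv f v z * g z)" for v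
    using dir_deriv_eqI[OF D] by auto
  moreover have "elementary (\<lambda>z. f z * dir_deriv g v z + dir_deriv f v z * g z)" for v
    by (intro elementary.add elementary.mult) (use mult in auto)
  ultimately show ?case using D differentiableI by simp blast
next
  case (exp f)
  have D: "((\<lambda>z. exp (f z)) has_derivative (\<lambda>v. exp (f z) * dir_deriv f v z)) (at z)" for z
    using exp.IH unfolding dir_deriv_def
    by (auto intro!: derivative_eq_intros simp: frechet_derivative_works[symmetric])
  have "dir_deriv (\<lambda>z. exp (f z)) v = (\<lambda>z. exp (f z) * dir_deriv f v z)" for v
    using dir_deriv_eqI[OF D] by auto
  moreover have "elementary (\<lambda>z. exp (f z) * dir_deriv f v z)" for v
    by (intro elementary.mult elementary.exp) (use exp in auto)
  ultimately show ?case using D differentiableI by simp blast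
qed

lemma elementary_differentiable: "elementary f \<Longrightarrow> f differentiable (at z)"
  using elementary_dir_deriv by blast

lemma elementary_continuous_on: "elementary f \<Longrightarrow> continuous_on S f"
  by (simp add: continuous_at_imp_continuous_on differentiable_imp_continuous_within
      elementary_differentiable)

lemma elementary_smooth_on:
  assumes "elementary f"
  shows "smooth_on f S"
proof -
  have "Ck_on k f S" for k
    using assms
    by (induction k arbitrary: f)
       (auto simp: elementary_continuous_on elementary_dir_deriv)
  then show ?thesis by (simp add: smooth_on_def)
qed

lemma elementary_power: "elementary f \<Longrightarrow> elementary (\<lambda>z. f z ^ n)"
  by (induction n) (simp_all add: elementary.const elementary.mult)

lemma elementary_fst_inner: "elementary (\<lambda>z::'a::euclidean_space \<times> real. fst z \<bullet> a)"
  using elementary.linear[of "(a, 0::real)"] by (simp add: inner_prod_def)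

lemma elementary_snd: "elementary (\<lambda>z::'a::euclidean_space \<times> real. snd z)"
  using elementary.linear[of "(0::'a, 1::real)"] by (simp add: inner_prod_def)

lemma elementary_diff: "elementary f \<Longrightarrow> elementary g \<Longrightarrow> elementary (\<lambda>z. f z - g z)"
  using elementary.add[of f "\<lambda>z. (-1) * g z"] elementary.mult[of "\<lambda>_. -1" g]
  by (simp add: elementary.const)

section \<open>One-sided bounds for the curvature operator\<close>

text \<open>The inequality \<open>F\<^sub>*(p, X) \<ge> s\<close> in real numbers. Since the operator is odd, it bounds both the lower
envelope at \<open>(p, X)\<close> and the upper envelope at \<open>(-p, -X)\<close>.\<close>

definition curvature_ge :: "real^'d \<Rightarrow> real^'d^'d \<Rightarrow> real \<Rightarrow> bool" where
  "curvature_ge p X s \<longleftrightarrow>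
     (\<forall>\<eta>>0. \<exists>r>0. \<forall>y\<in>mcf_dom \<inter> ball (p, X) r. s - \<eta> \<le> mcf_op y)"

lemma curvature_ge_lower:
  assumes "curvature_ge p X s"
  shows "ereal s \<le> mcf_lower (p, X)"
proof (rule ereal_le_epsilon2)
  fix \<eta> :: real assume "0 < \<eta>"
  then obtain r where r: "r > 0" "\<forall>y\<in>mcf_dom \<inter> ball (p, X) r. s - \<eta> \<le> mcf_op y"
    using assms unfolding curvature_ge_def by blast
  have "ereal (s - \<eta>) \<le> (INF y\<in>mcf_dom \<inter> ball (p, X) r. ereal (mcf_op y))"
    using r by (auto intro!: INF_greatest)
  also have "\<dots> \<le> mcf_lower (p, X)"
    unfolding lsc_env_def using r by (auto intro!: SUP_upper)
  finally show "ereal s \<le> mcf_lower (p, X) + ereal \<eta>"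
    by (cases "mcf_lower (p, X)") auto
qed

lemma mcf_op_uminus: "mcf_op (- p, - X) = - mcf_op (p, X)"
proof -
  have "trace (M ** (- X)) = - trace (M ** X)" for M :: "real^'a^'a"
    by (simp add: trace_def matrix_matrix_mult_def sum_negf)
  moreover have "tensor (- p) (- p) = tensor p p"
    by (simp add: tensor_def)
  ultimately show ?thesis by (simp add: mcf_op_def)
qed

lemma curvature_ge_upper:
  assumes "curvature_ge p X s"
  shows "mcf_upper (- p, - X) \<le> ereal (- s)"
proof (rule ereal_le_epsilon2)
  fix \<eta> :: real assume "0 < \<eta>"
  then obtain r where r: "r > 0" "\<forall>y\<in>mcf_dom \<inter> ball (p, X) r. s - \<eta> \<le> mcf_op y"
    using assms unfolding curvature_ge_def by blast
  have "ereal (mcf_op y) \<le> ereal (- s + \<eta>)" if y: "y \<in> mcf_dom \<inter> ball (- p, - X) r" for y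
  proof -
    obtain q Y where qY: "y = (q, Y)" by (cases y)
    have "(- q, - Y) \<in> mcf_dom"
      using y unfolding qY mcf_dom_def by (auto simp: transpose_def vec_eq_iff)
    moreover have "dist (p, X) (- q, - Y) = dist (- p, - X) (q, Y)"
      using dist_minus[of "(p, X)" "(- q, - Y)"] by simp
    ultimately have "s - \<eta> \<le> mcf_op (- q, - Y)"
      using r y qY by auto
    then show ?thesis using mcf_op_uminus[of q Y] qY by simp
  qed
  then have "(SUP y\<in>mcf_dom \<inter> ball (- p, - X) r. ereal (mcf_op y)) \<le> ereal (- s + \<eta>)"
    by (auto intro!: SUP_least)
  moreover have "mcf_upper (- p, - X) \<le> (SUP y\<in>mcf_dom \<inter> ball (- p, - X) r. ereal (mcf_op y))"
    unfolding usc_env_def using r by (auto intro!: INF_lower)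
  ultimately show "mcf_upper (- p, - X) \<le> ereal (- s) + ereal \<eta>" by simp
qed

lemma env_eq_continuous:
  assumes "continuous_on spacetime u" "t \<ge> 0"
  shows "usc_env spacetime u (x, t) = ereal (u (x, t))"
    and "lsc_env spacetime u (x, t) = ereal (u (x, t))"
proof -
  let ?z = "(x, t)"
  have mem: "?z \<in> spacetime" using assms by (simp add: spacetime_def)
  have close: "\<exists>r>0. \<forall>y\<in>spacetime \<inter> ball ?z r. \<bar>u y - u ?z\<bar> \<le> \<eta>" if \<eta>: "\<eta> > 0" for \<eta>
  proof -
    obtain r where r: "r > 0" "\<And>y. y \<in> spacetime \<Longrightarrow> dist y ?z < r \<Longrightarrow> dist (u y) (u ?z) < \<eta>"
      using assms(1)[unfolded continuous_on_iff, rule_format, OF mem \<eta>] by blast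
    have "\<bar>u y - u ?z\<bar> \<le> \<eta>" if "y \<in> spacetime \<inter> ball ?z r" for y
      using r(2)[of y] that unfolding dist_real_def Int_iff mem_ball dist_commute[of ?z]
      by linarith
    with r(1) show ?thesis by blast
  qed
  show "usc_env spacetime u ?z = ereal (u ?z)"
  proof (rule antisym)
    show "usc_env spacetime u ?z \<le> ereal (u ?z)"
    proof (rule ereal_le_epsilon2)
      fix \<eta> :: real assume "0 < \<eta>"
      from close[OF this] obtain r where r: "r > 0"
        "\<And>y. y \<in> spacetime \<inter> ball ?z r \<Longrightarrow> \<bar>u y - u ?z\<bar> \<le> \<eta>" by blast
      have "usc_env spacetime u ?z \<le> (SUP y\<in>spacetime \<inter> ball ?z r. ereal (u y))"
        unfolding usc_env_def using r(1) by (auto intro!: INF_lower)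
      also have "\<dots> \<le> ereal (u ?z + \<eta>)"
      proof (rule SUP_least)
        fix y assume "y \<in> spacetime \<inter> ball ?z r"
        from r(2)[OF this] show "ereal (u y) \<le> ereal (u ?z + \<eta>)"
          unfolding ereal_less_eq by linarith
      qed
      finally show "usc_env spacetime u ?z \<le> ereal (u ?z) + ereal \<eta>" by simp
    qed
    show "ereal (u ?z) \<le> usc_env spacetime u ?z"
      unfolding usc_env_def
    proof (rule INF_greatest)
      fix r :: real assume "r \<in> {0<..}"
      with mem have "?z \<in> spacetime \<inter> ball ?z r" by simp
      then show "ereal (u ?z) \<le> (SUP y\<in>spacetime \<inter> ball ?z r. ereal (u y))"
        by (rule SUP_upper)
    qed
  qed
  show "lsc_env spacetime u ?z = ereal (u ?z)"
  proof (rule antisym)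
    show "ereal (u ?z) \<le> lsc_env spacetime u ?z"
    proof (rule ereal_le_epsilon2)
      fix \<eta> :: real assume "0 < \<eta>"
      from close[OF this] obtain r where r: "r > 0"
        "\<And>y. y \<in> spacetime \<inter> ball ?z r \<Longrightarrow> \<bar>u y - u ?z\<bar> \<le> \<eta>" by blast
      have "ereal (u ?z - \<eta>) \<le> (INF y\<in>spacetime \<inter> ball ?z r. ereal (u y))"
      proof (rule INF_greatest)
        fix y assume "y \<in> spacetime \<inter> ball ?z r"
        from r(2)[OF this] show "ereal (u ?z - \<eta>) \<le> ereal (u y)"
          unfolding ereal_less_eq by linarith
      qed
      also have "\<dots> \<le> lsc_env spacetime u ?z"
        unfolding lsc_env_def using r(1) by (auto intro!: SUP_upper)
      finally show "ereal (u ?z) \<le> lsc_env spacetime u ?z + ereal \<eta>"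
        by (cases "lsc_env spacetime u ?z") auto
    qed
    show "lsc_env spacetime u ?z \<le> ereal (u ?z)"
      unfolding lsc_env_def
    proof (rule SUP_least)
      fix r :: real assume "r \<in> {0<..}"
      with mem have "?z \<in> spacetime \<inter> ball ?z r" by simp
      then show "(INF y\<in>spacetime \<inter> ball ?z r. ereal (u y)) \<le> ereal (u ?z)"
        by (rule INF_lower)
    qed
  qed
qed

section \<open>Subflows\<close>

text \<open>What the viscosity inequality says inside \<open>C\<close> at the points where \<open>v\<close> exceeds \<open>\<theta>\<close>. The threshold
keeps \<open>v\<close> away from the obstacle. Both \<open>u\<close> and \<open>-u\<close> have this property, for a sub- and a
supersolution \<open>u\<close> respectively, so the barrier arguments are needed only once.\<close>

definition curvature_subflow :: "real \<Rightarrow> (real^'d) set \<Rightarrow> ((real^'d) \<times> real \<Rightarrow> real) \<Rightarrow> bool" where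
  "curvature_subflow \<theta> C v \<longleftrightarrow>
     (\<forall>\<phi> x t s. elementary \<phi> \<and> t > 0 \<and> x \<in> interior C \<and> \<theta> < v (x, t) \<and>
        (\<forall>\<^sub>F z in nhds (x, t). v z - \<phi> z \<le> v (x, t) - \<phi> (x, t)) \<and>
        curvature_ge (space_grad \<phi> (x, t)) (space_hess \<phi> (x, t)) s
      \<longrightarrow> time_deriv \<phi> (x, t) + s \<le> 0)"

lemma eventually_env_eq:
  fixes u :: "(real^'d) \<times> real \<Rightarrow> real"
  assumes "continuous_on spacetime u" "t > 0"
  shows "\<forall>\<^sub>F z in nhds (x, t). usc_env spacetime u z = ereal (u z) \<and>
           lsc_env spacetime u z = ereal (u z)"
proof (rule eventually_nhds[THEN iffD2], intro exI conjI ballI)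
  show "open (spacetime_pos :: ((real^'d) \<times> real) set)"
    unfolding spacetime_pos_def by (intro open_Times) auto
  show "(x, t) \<in> spacetime_pos"
    using assms by (simp add: spacetime_pos_def)
  fix z :: "(real^'d) \<times> real"
  assume "z \<in> spacetime_pos"
  then have z: "snd z \<ge> 0" by (auto simp: spacetime_pos_def)
  show "usc_env spacetime u z = ereal (u z)" "lsc_env spacetime u z = ereal (u z)"
    using env_eq_continuous[OF assms(1) z, of "fst z"] by simp_all
qed

lemma subsolution_curvature_subflow:
  assumes sub: "viscosity_subsolution 0 \<Psi>m \<Psi>p u0 u" and cont: "continuous_on spacetime u"
    and below: "\<And>x. x \<in> C \<Longrightarrow> \<Psi>m x \<le> \<theta>"
  shows "curvature_subflow \<theta> C u"
  unfolding curvature_subflow_def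
proof (intro allI impI, elim conjE)
  fix \<phi> x t s
  assume \<phi>: "elementary \<phi>" and t: "t > 0" and x: "x \<in> interior C" and \<theta>: "\<theta> < u (x, t)"
    and max: "\<forall>\<^sub>F z in nhds (x, t). u z - \<phi> z \<le> u (x, t) - \<phi> (x, t)"
    and s: "curvature_ge (space_grad \<phi> (x, t)) (space_hess \<phi> (x, t)) s"
  have env: "usc_env spacetime u (x, t) = ereal (u (x, t))"
    using env_eq_continuous(1)[OF cont] t by simp
  have "\<forall>\<^sub>F z in nhds (x, t). usc_env spacetime u z - ereal (\<phi> z)
            \<le> usc_env spacetime u (x, t) - ereal (\<phi> (x, t))"
    using eventually_env_eq[OF cont t] max
    by eventually_elim (simp add: env)
  moreover have "usc_env spacetime u (x, t) > ereal (\<Psi>m x)"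
    using below[of x] x \<theta> interior_subset[of C] by (auto simp: env)
  ultimately have "ereal (time_deriv \<phi> (x, t)) +
      mcf_lower (space_grad \<phi> (x, t), space_hess \<phi> (x, t)) \<le> 0"
    using sub elementary_smooth_on[OF \<phi>] t
    unfolding viscosity_subsolution_def by fastforce
  moreover have "ereal (time_deriv \<phi> (x, t)) + ereal s \<le> ereal (time_deriv \<phi> (x, t)) +
      mcf_lower (space_grad \<phi> (x, t), space_hess \<phi> (x, t))"
    by (intro add_left_mono curvature_ge_lower s)
  ultimately have "ereal (time_deriv \<phi> (x, t)) + ereal s \<le> 0" by (rule order_trans[rotated])
  then show "time_deriv \<phi> (x, t) + s \<le> 0" by simp
qed

lemma dir_deriv_uminus:
  assumes "elementary f"
  shows "dir_deriv (\<lambda>z. - f z) v = (\<lambda>z. - dir_deriv f v z)"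
proof
  fix z
  have "((\<lambda>z. - f z) has_derivative (\<lambda>v. - dir_deriv f v z)) (at z)"
    using elementary_differentiable[OF assms, of z] unfolding dir_deriv_def
    by (intro has_derivative_minus) (simp add: frechet_derivative_works[symmetric])
  from dir_deriv_eqI[OF this] show "dir_deriv (\<lambda>z. - f z) v z = - dir_deriv f v z" .
qed

lemma supersolution_curvature_subflow:
  assumes super: "viscosity_supersolution 0 \<Psi>m \<Psi>p u0 u" and cont: "continuous_on spacetime u"
    and above: "\<And>x. x \<in> C \<Longrightarrow> - \<theta> \<le> \<Psi>p x"
  shows "curvature_subflow \<theta> C (\<lambda>z. - u z)"
  unfolding curvature_subflow_def
proof (intro allI impI, elim conjE)
  fix \<phi> x t s
  assume \<phi>: "elementary \<phi>" and t: "t > 0" and x: "x \<in> interior C" and \<theta>: "\<theta> < - u (x, t)"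
    and max: "\<forall>\<^sub>F z in nhds (x, t). - u z - \<phi> z \<le> - u (x, t) - \<phi> (x, t)"
    and s: "curvature_ge (space_grad \<phi> (x, t)) (space_hess \<phi> (x, t)) s"
  let ?\<psi> = "\<lambda>z. - \<phi> z"
  have \<psi>: "elementary ?\<psi>"
    using elementary.mult[OF elementary.const[of "-1"] \<phi>] by simp
  have dd: "elementary (dir_deriv \<phi> v)" for v
    using elementary_dir_deriv[OF \<phi>] by blast
  have grad: "space_grad ?\<psi> (x, t) = - space_grad \<phi> (x, t)"
    by (simp add: space_grad_def dir_deriv_uminus[OF \<phi>] vec_eq_iff)
  have hess: "space_hess ?\<psi> (x, t) = - space_hess \<phi> (x, t)"
    by (simp add: space_hess_def dir_deriv_uminus[OF \<phi>] dir_deriv_uminus[OF dd] vec_eq_iff)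
  have time: "time_deriv ?\<psi> (x, t) = - time_deriv \<phi> (x, t)"
    by (simp add: time_deriv_def dir_deriv_uminus[OF \<phi>])
  have env: "lsc_env spacetime u (x, t) = ereal (u (x, t))"
    using env_eq_continuous(2)[OF cont] t by simp
  have "\<forall>\<^sub>F z in nhds (x, t). lsc_env spacetime u z - ereal (?\<psi> z)
            \<ge> lsc_env spacetime u (x, t) - ereal (?\<psi> (x, t))"
    using eventually_env_eq[OF cont t] max
    by eventually_elim (simp add: env)
  moreover have "lsc_env spacetime u (x, t) < ereal (\<Psi>p x)"
    using above[of x] x \<theta> interior_subset[of C] by (auto simp: env)
  ultimately have "ereal (time_deriv ?\<psi> (x, t)) +
      mcf_upper (space_grad ?\<psi> (x, t), space_hess ?\<psi> (x, t)) \<ge> 0"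
    using super elementary_smooth_on[OF \<psi>] t
    unfolding viscosity_supersolution_def by fastforce
  moreover have "ereal (time_deriv ?\<psi> (x, t)) + ereal (- s) \<ge> ereal (time_deriv ?\<psi> (x, t)) +
      mcf_upper (space_grad ?\<psi> (x, t), space_hess ?\<psi> (x, t))"
    unfolding grad hess by (intro add_left_mono curvature_ge_upper s)
  ultimately have "ereal (time_deriv ?\<psi> (x, t)) + ereal (- s) \<ge> 0" by (rule order_trans)
  then show "time_deriv \<phi> (x, t) + s \<le> 0" by (simp add: time)
qed

section \<open>Comparison with smooth barriers\<close>

text \<open>The parabolic maximum principle. The penalty \<open>P\<close> grows in time, which makes the barrier strict. At
time \<open>T\<close> it is half of the supposed excess \<open>m\<close>, but at \<open>T'\<close> it reaches the largest value of \<open>v - w\<close>, so that the maximum of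
\<open>v - w - P\<close> is not attained at the final time and is a genuine local maximum in space-time.\<close>

lemma curvature_comparison:
  fixes v w :: "(real^'d) \<times> real \<Rightarrow> real"
  assumes "compact C" "0 \<le> T" "T < T'" and cont: "continuous_on (C \<times> {0..T'}) v"
    and sub: "curvature_subflow \<theta> C v" and w: "elementary w"
    and barrier: "\<And>x t. x \<in> C \<Longrightarrow> 0 \<le> t \<Longrightarrow> t \<le> T' \<Longrightarrow> v (x, t) \<le> w (x, t) \<or>
      x \<in> interior C \<and> 0 < t \<and> \<theta> \<le> w (x, t) \<and>
      curvature_ge (space_grad w (x, t)) (space_hess w (x, t)) (- time_deriv w (x, t))"
    and x1: "x1 \<in> C"
  shows "v (x1, T) \<le> w (x1, T)"
proof (rule ccontr)
  assume neg: "\<not> v (x1, T) \<le> w (x1, T)"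
  define m where "m = v (x1, T) - w (x1, T)"
  have m: "m > 0" using neg by (simp add: m_def)
  have comp: "compact (C \<times> {0..T'})"
    using assms(1) by (intro compact_Times) auto
  have ne: "C \<times> {0..T'} \<noteq> {}" using x1 assms by auto
  have contw: "continuous_on (C \<times> {0..T'}) w" by (rule elementary_continuous_on[OF w])
  obtain zM where zM: "\<And>z. z \<in> C \<times> {0..T'} \<Longrightarrow> v z - w z \<le> v zM - w zM"
    using continuous_attains_sup[OF comp ne continuous_on_diff[OF cont contw]] by blast
  define M where "M = v zM - w zM"
  have Mm: "m \<le> M" using zM[of "(x1, T)"] x1 assms by (simp add: M_def m_def)
  \<comment> \<open>The rate \<open>K\<close> is chosen such that \<open>(m / 2) * exp (K * (T' - T)) \<ge> M\<close>, by \<open>exp x \<ge> x\<close>.\<close>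
  define K where "K = (2 * M / m) / (T' - T)"
  have K: "K > 0" using m Mm assms by (simp add: K_def)
  define P where "P = (\<lambda>z::(real^'d) \<times> real. (m / 2) * exp (K * (snd z - T)))"
  have PT': "P (x, T') \<ge> M" for x
  proof -
    have "2 * M / m = K * (T' - T)" using assms by (simp add: K_def)
    also have "\<dots> \<le> exp (K * (T' - T))"
      using exp_ge_add_one_self[of "K * (T' - T)"] by linarith
    finally have "(m / 2) * (2 * M / m) \<le> P (x, T')"
      using m unfolding P_def snd_conv by (intro mult_left_mono) auto
    then show ?thesis using m by simp
  qed
  have P: "elementary P"
    unfolding P_def
    by (intro elementary.mult elementary.exp elementary_diff elementary_snd elementary.const)
  define \<phi> where "\<phi> = (\<lambda>z. w z + P z)"
  have \<phi>: "elementary \<phi>" unfolding \<phi>_def by (intro elementary.add w P)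
  obtain z0 where z0: "z0 \<in> C \<times> {0..T'}"
    "\<And>z. z \<in> C \<times> {0..T'} \<Longrightarrow> v z - \<phi> z \<le> v z0 - \<phi> z0"
    using continuous_attains_sup[OF comp ne
        continuous_on_diff[OF cont elementary_continuous_on[OF \<phi>]]] by blast
  obtain x t where xt: "z0 = (x, t)" by (cases z0)
  have x: "x \<in> C" and t: "0 \<le> t" "t \<le> T'" using z0(1) xt by auto
  have "\<phi> (x1, T) = w (x1, T) + m / 2" by (simp add: \<phi>_def P_def)
  then have "m / 2 = v (x1, T) - \<phi> (x1, T)" unfolding m_def by argo
  also have "\<dots> \<le> v (x, t) - \<phi> (x, t)" using z0(2)[of "(x1, T)"] x1 assms xt by auto
  finally have pos: "v (x, t) - \<phi> (x, t) \<ge> m / 2" .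
  have Ppos: "P z > 0" for z using m by (simp add: P_def)
  have gt: "v (x, t) > w (x, t)" using pos Ppos[of "(x, t)"] m by (simp add: \<phi>_def)
  from barrier[OF x t] gt have int: "x \<in> interior C" "0 < t" "\<theta> < v (x, t)"
    and curv: "curvature_ge (space_grad w (x, t)) (space_hess w (x, t)) (- time_deriv w (x, t))"
    by auto
  have "t \<noteq> T'"
    using pos PT'[of x] zM[of "(x, t)"] x t m by (auto simp: \<phi>_def M_def)
  with t have "t < T'" by simp
  have "\<forall>\<^sub>F z in nhds (x, t). v z - \<phi> z \<le> v (x, t) - \<phi> (x, t)"
  proof (rule eventually_nhds[THEN iffD2], intro exI conjI ballI)
    show "open (interior C \<times> {0<..<T'})" by (intro open_Times) auto
    show "(x, t) \<in> interior C \<times> {0<..<T'}" using int \<open>t < T'\<close> by simp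
    fix z assume "z \<in> interior C \<times> {0<..<T'}"
    then have "z \<in> C \<times> {0..T'}" using interior_subset[of C] by auto
    from z0(2)[OF this] show "v z - \<phi> z \<le> v (x, t) - \<phi> (x, t)" by (simp add: xt)
  qed
  moreover have dd: "dir_deriv \<phi> a z = dir_deriv w a z + P z * (K * snd a)" for a z
  proof -
    have "(P has_derivative (\<lambda>a. P z * (K * snd a))) (at z)"
      unfolding P_def by (auto intro!: derivative_eq_intros ext simp: algebra_simps)
    moreover have "(w has_derivative (\<lambda>a. dir_deriv w a z)) (at z)"
      using elementary_differentiable[OF w, of z] unfolding dir_deriv_def
      by (simp add: frechet_derivative_works[symmetric])
    ultimately show ?thesis
      unfolding \<phi>_def by (intro dir_deriv_eqI has_derivative_add) auto
  qed
  have "dir_deriv \<phi> (axis j 1, 0) = dir_deriv w (axis j 1, 0)" for j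
    by (rule ext) (simp add: dd)
  then have "space_grad \<phi> (x, t) = space_grad w (x, t)" "space_hess \<phi> (x, t) = space_hess w (x, t)"
    by (simp_all add: space_grad_def space_hess_def)
  ultimately have "time_deriv \<phi> (x, t) + - time_deriv w (x, t) \<le> 0"
    using sub[unfolded curvature_subflow_def, rule_format,
        of \<phi> t x "- time_deriv w (x, t)"] int \<phi> curv by simp
  then have "P (x, t) * K \<le> 0" by (simp add: time_deriv_def dd)
  then show False using mult_pos_pos[OF Ppos[of "(x, t)"] K] by linarith
qed

section \<open>Planar barriers\<close>

lemma mcf_op_2:
  fixes p :: "real^2"
  shows "mcf_op (p, X) = - (X$1$1 + X$2$2) +
    (p$1 * p$1 * X$1$1 + p$1 * p$2 * X$2$1 + p$2 * p$1 * X$1$2 + p$2 * p$2 * X$2$2) / (norm p)\<^sup>2"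
  by (simp add: mcf_op_def trace_def matrix_matrix_mult_def tensor_def mat_def sum_2
      algebra_simps add_divide_distrib)

lemma norm_square_2: "(norm (p::real^2))\<^sup>2 = p$1 * p$1 + p$2 * p$2"
  by (simp only: power2_norm_eq_inner inner_vec_def sum_2 inner_real_def)

lemma curvature_ge_nonzero:
  fixes p :: "real^2"
  assumes "p \<noteq> 0" "s \<le> mcf_op (p, X)"
  shows "curvature_ge p X s"
  unfolding curvature_ge_def
proof (intro allI impI)
  fix \<eta> :: real assume "\<eta> > 0"
  have "isCont mcf_op (p, X)"
  proof -
    have "mcf_op = (\<lambda>z::(real^2) \<times> (real^2^2). - (snd z$1$1 + snd z$2$2) +
      (fst z$1 * fst z$1 * snd z$1$1 + fst z$1 * fst z$2 * snd z$2$1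
       + fst z$2 * fst z$1 * snd z$1$2 + fst z$2 * fst z$2 * snd z$2$2) / (norm (fst z))\<^sup>2)"
      using mcf_op_2 by (auto simp: fun_eq_iff)
    moreover have "isCont \<dots> (p, X)"
      using assms(1) by (intro continuous_intros) auto
    ultimately show ?thesis by simp
  qed
  then obtain r where r: "r > 0" "\<And>y. dist y (p, X) < r \<Longrightarrow> dist (mcf_op y) (mcf_op (p, X)) < \<eta>"
    using \<open>\<eta> > 0\<close> unfolding continuous_at_eps_delta by blast
  have "s - \<eta> \<le> mcf_op y" if "y \<in> mcf_dom \<inter> ball (p, X) r" for y
    using r(2)[of y] that assms(2) unfolding Int_iff mem_ball dist_commute[of "(p, X)"] dist_real_def
    by linarith
  with r(1) show "\<exists>r>0. \<forall>y\<in>mcf_dom \<inter> ball (p, X) r. s - \<eta> \<le> mcf_op y" by blast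
qed

text \<open>The operator is discontinuous at vanishing gradient, but it is dominated by the size of the
Hessian, uniformly in the direction of the gradient.\<close>

lemma curvature_ge_zero: "curvature_ge (p::real^2) 0 0"
  unfolding curvature_ge_def
proof (intro allI impI)
  fix \<eta> :: real assume "\<eta> > 0"
  have "0 - \<eta> \<le> mcf_op y" if y: "y \<in> mcf_dom \<inter> ball (p, 0) (\<eta> / 6)" for y
  proof -
    obtain q Y where qY: "y = (q, Y)" by (cases y)
    have q: "q \<noteq> 0" using y qY by (auto simp: mcf_dom_def)
    then have nq: "(norm q)\<^sup>2 > 0" by simp
    have "norm Y \<le> norm (y - (p, 0))" using norm_snd_le[of Y "q - p"] qY by simp
    also have "\<dots> < \<eta> / 6" using y by (simp add: dist_norm norm_minus_commute)
    finally have Y: "norm Y < \<eta> / 6" .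
    have YY: "\<bar>Y$i$j\<bar> \<le> \<eta> / 6" for i j
      using component_le_norm_cart[of "Y$i" j] Finite_Cartesian_Product.norm_nth_le[of Y i] Y by linarith
    have qq: "\<bar>q$i * q$j / (norm q)\<^sup>2\<bar> \<le> 1" for i j
    proof -
      have "\<bar>q$i * q$j\<bar> \<le> norm q * norm q"
        unfolding abs_mult by (intro mult_mono component_le_norm_cart) auto
      then show ?thesis using nq by (simp add: power2_eq_square)
    qed
    have prod: "\<bar>(q$i * q$j / (norm q)\<^sup>2) * Y$k$l\<bar> \<le> \<eta> / 6" for i j k l
    proof -
      have "\<bar>(q$i * q$j / (norm q)\<^sup>2) * Y$k$l\<bar> \<le> 1 * (\<eta> / 6)"
        unfolding abs_mult by (intro mult_mono qq YY) auto
      then show ?thesis by simp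
    qed
    have "mcf_op y = - (Y$1$1 + Y$2$2) + ((q$1 * q$1 / (norm q)\<^sup>2) * Y$1$1
        + (q$1 * q$2 / (norm q)\<^sup>2) * Y$2$1 + (q$2 * q$1 / (norm q)\<^sup>2) * Y$1$2
        + (q$2 * q$2 / (norm q)\<^sup>2) * Y$2$2)"
      unfolding qY mcf_op_2 by (simp add: add_divide_distrib)
    then show ?thesis
      using YY[of 1 1] YY[of 2 2] prod[of 1 1 1 1] prod[of 1 2 2 1] prod[of 2 1 1 2] prod[of 2 2 2 2]
      unfolding abs_le_iff by linarith
  qed
  then show "\<exists>r>0. \<forall>y\<in>mcf_dom \<inter> ball (p, 0) r. 0 - \<eta> \<le> mcf_op y"
    using \<open>\<eta> > 0\<close> by (intro exI[of _ "\<eta> / 6"]) auto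
qed

text \<open>The part of the Hessian along the gradient is projected away; of the isotropic part the one
tangential direction of the plane remains.\<close>

lemma mcf_op_radial:
  fixes y :: "real^2"
  assumes "y \<noteq> 0" "\<gamma> \<noteq> 0"
  shows "mcf_op (\<gamma> *\<^sub>R y, \<chi> i j. \<alpha> * (y$i * y$j) + (if i = j then \<beta> else 0)) = - \<beta>"
proof -
  have ny: "y$1 * y$1 + y$2 * y$2 \<noteq> 0"
    using assms(1) norm_square_2[of y] by (metis norm_eq_zero power_eq_0_iff)
  let ?a = "y$1" and ?b = "y$2"
  have "mcf_op (\<gamma> *\<^sub>R y, \<chi> i j. \<alpha> * (y$i * y$j) + (if i = j then \<beta> else 0)) =
     - (\<alpha> * (?a * ?a) + \<beta> + (\<alpha> * (?b * ?b) + \<beta>)) +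
     (\<gamma> * \<gamma> * ((?a * ?a + ?b * ?b) * (\<alpha> * (?a * ?a + ?b * ?b) + \<beta>)))
     / (\<gamma> * \<gamma> * (?a * ?a + ?b * ?b))"
    unfolding mcf_op_2 norm_square_2 by (simp add: algebra_simps)
  also have "(\<gamma> * \<gamma> * ((?a * ?a + ?b * ?b) * (\<alpha> * (?a * ?a + ?b * ?b) + \<beta>)))
     / (\<gamma> * \<gamma> * (?a * ?a + ?b * ?b)) = \<alpha> * (?a * ?a + ?b * ?b) + \<beta>"
    using ny assms(2) by simp
  also have "- (\<alpha> * (?a * ?a) + \<beta> + (\<alpha> * (?b * ?b) + \<beta>)) +
      (\<alpha> * (?a * ?a + ?b * ?b) + \<beta>) = - \<beta>" by (simp add: algebra_simps)
  finally show ?thesis .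
qed

lemma elementary_norm2_fst: "elementary (\<lambda>z::(real^2) \<times> real. (norm (fst z - c))\<^sup>2)"
proof -
  have "(\<lambda>z::(real^2) \<times> real. (norm (fst z - c))\<^sup>2) =
    (\<lambda>z. (fst z \<bullet> axis 1 1 - c$1) * (fst z \<bullet> axis 1 1 - c$1)
        + (fst z \<bullet> axis 2 1 - c$2) * (fst z \<bullet> axis 2 1 - c$2))"
    by (simp add: norm_square_2 inner_axis fun_eq_iff)
  moreover have "elementary \<dots>"
    by (intro elementary.add elementary.mult elementary_diff elementary_fst_inner elementary.const)
  ultimately show ?thesis by simp
qed

text \<open>The level sets are the circles \<open>|x - c|\<^sup>2 + 2 t = const\<close>, which move by curvature.\<close>

lemma shrinking_disc_barrier:
  fixes c :: "real^2" and M B \<theta> s :: real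
  assumes "M > 0" "B > 0"
  defines "w \<equiv> (\<lambda>z::(real^2) \<times> real. \<theta> + M * exp (- B * ((norm (fst z - c))\<^sup>2 + 2 * snd z - s)))"
  shows "elementary w"
    and "x \<noteq> c \<Longrightarrow> curvature_ge (space_grad w (x, t)) (space_hess w (x, t)) (- time_deriv w (x, t))"
proof -
  show "elementary w"
    unfolding w_def
    by (intro elementary.add elementary.mult elementary.exp elementary_diff elementary_norm2_fst
        elementary_snd elementary.const)
  define e where "e = (\<lambda>z::(real^2) \<times> real. M * exp (- B * ((norm (fst z - c))\<^sup>2 + 2 * snd z - s)))"
  have e0: "e z > 0" for z using assms(1) by (simp add: e_def)
  have e: "(e has_derivative (\<lambda>a. - 2 * B * (e z * ((fst z - c) \<bullet> fst a + snd a)))) (at z)" for z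
    unfolding e_def power2_norm_eq_inner
    by (rule derivative_eq_intros refl | simp)+
       (simp add: fun_eq_iff inner_commute algebra_simps)
  have w_e: "w = (\<lambda>z. \<theta> + e z)" by (simp add: w_def e_def)
  have d1: "dir_deriv w a = (\<lambda>z. - 2 * B * (e z * ((fst z - c) \<bullet> fst a + snd a)))" for a
  proof
    fix z
    have "(w has_derivative (\<lambda>a. - 2 * B * (e z * ((fst z - c) \<bullet> fst a + snd a)))) (at z)"
      unfolding w_e by (rule has_derivative_eq_rhs[OF has_derivative_add[OF has_derivative_const e]]) simp
    from dir_deriv_eqI[OF this]
    show "dir_deriv w a z = - 2 * B * (e z * ((fst z - c) \<bullet> fst a + snd a))" .
  qed
  have d2: "dir_deriv (dir_deriv w a) b z =
      4 * B\<^sup>2 * e z * ((fst z - c) \<bullet> fst b + snd b) * ((fst z - c) \<bullet> fst a + snd a)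
      - 2 * B * e z * (fst b \<bullet> fst a)" for a b z
  proof -
    have g: "((\<lambda>z. (fst z - c) \<bullet> fst a + snd a) has_derivative (\<lambda>b. fst b \<bullet> fst a)) (at z)"
      by (rule derivative_eq_intros refl | simp)+
    show ?thesis
      unfolding d1
      by (subst dir_deriv_eqI[OF has_derivative_mult[OF has_derivative_const has_derivative_mult[OF e g]]])
         (simp add: algebra_simps power2_eq_square)
  qed
  assume x: "x \<noteq> c"
  define \<gamma> where "\<gamma> = - 2 * B * e (x, t)"
  have \<gamma>: "\<gamma> \<noteq> 0" using e0[of "(x, t)"] assms(2) by (simp add: \<gamma>_def)
  have grad: "space_grad w (x, t) = \<gamma> *\<^sub>R (x - c)"
    by (simp add: space_grad_def d1 vec_eq_iff inner_axis \<gamma>_def)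
  have hess: "space_hess w (x, t) = (\<chi> i j. (4 * B\<^sup>2 * e (x, t)) * ((x - c)$i * (x - c)$j) + (if i = j then \<gamma> else 0))"
    by (simp add: space_hess_def d2 vec_eq_iff inner_axis inner_axis_axis \<gamma>_def) (simp add: axis_def)
  have time: "time_deriv w (x, t) = \<gamma>" by (simp add: time_deriv_def d1 \<gamma>_def)
  show "curvature_ge (space_grad w (x, t)) (space_hess w (x, t)) (- time_deriv w (x, t))"
  proof (rule curvature_ge_nonzero)
    show "space_grad w (x, t) \<noteq> 0" using \<gamma> x by (simp add: grad)
    show "- time_deriv w (x, t) \<le> mcf_op (space_grad w (x, t), space_hess w (x, t))"
      unfolding grad hess time by (subst mcf_op_radial) (use x \<gamma> in auto)
  qed
qed

text \<open>The level sets are straight lines, hence stationary. The exponent 4 makes gradient and Hessian vanish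
together on the central line; with exponent 2 the Hessian would survive there, and the lower
envelope of the operator would be negative.\<close>

lemma strip_barrier:
  fixes n a :: "real^2" and A \<theta> :: real
  assumes "norm n = 1" "A > 0"
  defines "w \<equiv> (\<lambda>z::(real^2) \<times> real. \<theta> + A * ((fst z - a) \<bullet> n) ^ 4)"
  shows "elementary w"
    and "curvature_ge (space_grad w (x, t)) (space_hess w (x, t)) (- time_deriv w (x, t))"
proof -
  have "w = (\<lambda>z. \<theta> + A * (fst z \<bullet> n - a \<bullet> n) ^ 4)" by (simp add: w_def inner_diff_left)
  moreover have "elementary \<dots>"
    by (intro elementary.add elementary.mult elementary_diff elementary_fst_inner
        elementary_power elementary.const)
  ultimately show "elementary w" by simp
  have d1: "dir_deriv w b = (\<lambda>z. 4 * A * ((fst z - a) \<bullet> n) ^ 3 * (fst b \<bullet> n))" for b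
  proof
    fix z
    have "(w has_derivative (\<lambda>b. 4 * A * ((fst z - a) \<bullet> n) ^ 3 * (fst b \<bullet> n))) (at z)"
      unfolding w_def by (rule derivative_eq_intros refl | simp)+ (simp add: fun_eq_iff)
    from dir_deriv_eqI[OF this]
    show "dir_deriv w b z = 4 * A * ((fst z - a) \<bullet> n) ^ 3 * (fst b \<bullet> n)" .
  qed
  have d2: "dir_deriv (dir_deriv w b) b' z =
      12 * A * ((fst z - a) \<bullet> n) ^ 2 * (fst b' \<bullet> n) * (fst b \<bullet> n)" for b b' z
  proof -
    have "((\<lambda>z. 4 * A * ((fst z - a) \<bullet> n) ^ 3 * (fst b \<bullet> n)) has_derivative
      (\<lambda>b'. 12 * A * ((fst z - a) \<bullet> n) ^ 2 * (fst b' \<bullet> n) * (fst b \<bullet> n))) (at z)"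
      by (rule derivative_eq_intros refl | simp)+ (simp add: fun_eq_iff)
    from dir_deriv_eqI[OF this] show ?thesis unfolding d1 .
  qed
  define y where "y = (x - a) \<bullet> n"
  have grad: "space_grad w (x, t) = (4 * A * y ^ 3) *\<^sub>R n"
    by (simp add: space_grad_def d1 vec_eq_iff inner_axis' y_def)
  have hess: "space_hess w (x, t) = (\<chi> i j. (12 * A * y\<^sup>2) * (n$i * n$j) + (if i = j then 0 else 0))"
    by (simp add: space_hess_def d2 vec_eq_iff inner_axis' y_def)
  have time: "time_deriv w (x, t) = 0" by (simp add: time_deriv_def d1)
  show "curvature_ge (space_grad w (x, t)) (space_hess w (x, t)) (- time_deriv w (x, t))"
  proof (cases "y = 0")
    case True
    then have "space_hess w (x, t) = 0" by (simp add: hess vec_eq_iff)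
    then show ?thesis using curvature_ge_zero time by simp
  next
    case False
    have n: "n \<noteq> 0" using assms(1) by auto
    show ?thesis
    proof (rule curvature_ge_nonzero)
      show "space_grad w (x, t) \<noteq> 0" using False n assms(2) by (simp add: grad)
      show "- time_deriv w (x, t) \<le> mcf_op (space_grad w (x, t), space_hess w (x, t))"
        unfolding grad hess time by (subst mcf_op_radial) (use n False assms(2) in auto)
    qed
  qed
qed

text \<open>In \<open>C\<close> outside the disc of radius \<open>R\<close> the set \<open>{v > \<theta>}\<close> stays inside the circle that shrinks to
the radius \<open>R\<close> at time \<open>T\<close>. The barrier is \<open>\<theta>\<close> plus a multiple \<open>M\<close> of an exponential that is at least
1 inside the shrinking circle, where \<open>\<theta> + M\<close> dominates \<open>v\<close>; outside it the exponential is as small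
as desired.\<close>

lemma subflow_confined_to_disc:
  fixes c :: "real^2"
  assumes C: "compact C" and T: "0 \<le> T" and cont: "continuous_on (C \<times> {0..T+1}) v"
    and sub: "curvature_subflow \<theta> C v"
    and bd: "\<And>x. x \<in> C \<Longrightarrow> x \<notin> interior C \<Longrightarrow> R < dist c x \<Longrightarrow> \<forall>t\<in>{0..T+1}. v (x, t) \<le> \<theta>"
    and init: "\<And>x. x \<in> C \<Longrightarrow> R\<^sup>2 + 2 * T \<le> (dist c x)\<^sup>2 \<Longrightarrow> v (x, 0) \<le> \<theta>"
    and x1: "x1 \<in> C" "R < dist c x1" and R: "0 \<le> R"
  shows "v (x1, T) \<le> \<theta>"
proof (rule ccontr)
  assume neg: "\<not> v (x1, T) \<le> \<theta>"
  have comp: "compact (C \<times> {0..T+1})" using C by (intro compact_Times) auto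
  obtain zM where zM: "zM \<in> C \<times> {0..T+1}" "\<And>z. z \<in> C \<times> {0..T+1} \<Longrightarrow> v z \<le> v zM"
    using continuous_attains_sup[OF comp _ cont] x1 T by fastforce
  define M where "M = v zM - \<theta>"
  have "v (x1, T) \<le> v zM" using zM(2) x1 T by auto
  then have M: "M > 0" "v (x1, T) - \<theta> \<le> M" using neg by (auto simp: M_def)
  have RR: "R\<^sup>2 < (dist c x1)\<^sup>2" using x1 R by (intro power_strict_mono) auto
  \<comment> \<open>The comparison needs a time interval that extends beyond \<open>T\<close>. The extension \<open>\<tau>\<close> is so short
    that \<open>x1\<close> is outside the shrinking circle at time \<open>T\<close> when the radius \<open>R\<close> is reached only at
    time \<open>T + \<tau>\<close>.\<close>
  define \<tau> where "\<tau> = min 1 (((dist c x1)\<^sup>2 - R\<^sup>2) / 4)"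
  have \<tau>: "0 < \<tau>" "\<tau> \<le> 1" "2 * \<tau> < (dist c x1)\<^sup>2 - R\<^sup>2"
    using RR by (auto simp: \<tau>_def min_def)
  define s where "s = R\<^sup>2 + 2 * (T + \<tau>)"
  define d where "d = (norm (x1 - c))\<^sup>2 + 2 * T - s"
  have d: "d > 0" using \<tau>(3) by (simp add: d_def s_def dist_norm norm_minus_commute)
  define \<epsilon> where "\<epsilon> = (v (x1, T) - \<theta>) / M"
  have \<epsilon>: "\<epsilon> > 0" using neg M by (simp add: \<epsilon>_def)
  \<comment> \<open>Steep enough for \<open>exp (- B * d) < \<epsilon>\<close>: the barrier at \<open>(x1, T)\<close> is then less than \<open>v (x1, T)\<close>.\<close>
  define B where "B = 1 / (d * \<epsilon>)"
  have B: "B > 0" using d \<epsilon> by (simp add: B_def)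
  define w where "w = (\<lambda>z::(real^2) \<times> real. \<theta> + M * exp (- B * ((norm (fst z - c))\<^sup>2 + 2 * snd z - s)))"
  have w0: "w z > \<theta>" for z using M by (simp add: w_def)
  have w1: "v z \<le> w z" if "z \<in> C \<times> {0..T+1}" "(norm (fst z - c))\<^sup>2 + 2 * snd z \<le> s" for z
  proof -
    have "0 \<le> - B * ((norm (fst z - c))\<^sup>2 + 2 * snd z - s)"
      using that B by (simp add: mult_le_0_iff)
    then have "1 \<le> exp (- B * ((norm (fst z - c))\<^sup>2 + 2 * snd z - s))" by simp
    then have "M * 1 \<le> M * exp (- B * ((norm (fst z - c))\<^sup>2 + 2 * snd z - s))"
      using M by (intro mult_left_mono) auto
    then show ?thesis using zM(2)[OF that(1)] by (simp add: w_def M_def)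
  qed
  have "v (x1, T) \<le> w (x1, T)"
  proof (rule curvature_comparison[where T'="T + \<tau>" and \<theta>=\<theta> and C=C])
    show "continuous_on (C \<times> {0..T + \<tau>}) v"
      using \<tau> by (intro continuous_on_subset[OF cont]) auto
    show "elementary w" unfolding w_def by (rule shrinking_disc_barrier[OF M(1) B])
    fix x t assume x: "x \<in> C" and t: "0 \<le> t" "t \<le> T + \<tau>"
    then have xt: "(x, t) \<in> C \<times> {0..T+1}" using \<tau> by auto
    show "v (x, t) \<le> w (x, t) \<or> x \<in> interior C \<and> 0 < t \<and> \<theta> \<le> w (x, t) \<and>
      curvature_ge (space_grad w (x, t)) (space_hess w (x, t)) (- time_deriv w (x, t))"
    proof (cases "dist c x \<le> R")
      case True
      then have "(dist c x)\<^sup>2 \<le> R\<^sup>2" by (intro power_mono) auto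
      then have "v (x, t) \<le> w (x, t)"
        using t by (intro w1[OF xt]) (simp add: s_def dist_norm norm_minus_commute)
      then show ?thesis ..
    next
      case far: False
      show ?thesis
      proof (cases "x \<in> interior C")
        case False
        then show ?thesis using bd[OF x False] far xt w0[of "(x, t)"] by force
      next
        case int: True
        show ?thesis
        proof (cases "t = 0")
          case True
          show ?thesis
          proof (cases "(dist c x)\<^sup>2 \<le> s")
            case le: True
            then have "v (x, t) \<le> w (x, t)"
              using True by (intro w1[OF xt]) (simp add: dist_norm norm_minus_commute)
            then show ?thesis ..
          next
            case False
            then have "v (x, 0) \<le> \<theta>" using \<tau> by (intro init x) (simp add: s_def)
            then show ?thesis using True w0[of "(x, t)"] by simp
          qed
        next
          case False
          have "x \<noteq> c" using far R by auto
          from shrinking_disc_barrier(2)[OF M(1) B this]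
          have "curvature_ge (space_grad w (x, t)) (space_hess w (x, t)) (- time_deriv w (x, t))"
            unfolding w_def .
          then show ?thesis using int False t w0[of "(x, t)"] by simp
        qed
      qed
    qed
  qed (use C T \<tau> sub x1 in auto)
  moreover have "w (x1, T) < v (x1, T)"
  proof -
    have Bd: "B * d = 1 / \<epsilon>" using d by (simp add: B_def)
    have "1 / \<epsilon> < exp (1 / \<epsilon>)"
      using exp_ge_add_one_self[of "1 / \<epsilon>"] by linarith
    then have "exp (- (1 / \<epsilon>)) < \<epsilon>"
      using \<epsilon> by (simp add: exp_minus field_simps)
    then have "M * exp (- B * d) < M * \<epsilon>"
      using M Bd by (intro mult_strict_left_mono) auto
    also have "M * \<epsilon> = v (x1, T) - \<theta>" using M by (simp add: \<epsilon>_def)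
    finally show ?thesis by (simp add: w_def d_def)
  qed
  ultimately show False by simp
qed

section \<open>Solutions and their level sets\<close>

text \<open>Open evolutions are sets \<open>{u \<in> G}\<close> for the first choice of \<open>G\<close>, closed evolutions for the second.\<close>

definition level_range :: "real set \<Rightarrow> bool" where
  "level_range G \<longleftrightarrow> G = {0<..} \<or> G = {0..}"

lemma level_range_mono: "level_range G \<Longrightarrow> r \<in> G \<Longrightarrow> r \<le> s \<Longrightarrow> s \<in> G"
  by (auto simp: level_range_def)

lemma level_compact_lower:
  assumes G: "level_range G" and "compact Z" "continuous_on Z f" "\<And>z. z \<in> Z \<Longrightarrow> f z \<in> G"
  obtains \<delta> where "\<delta> \<in> G" "\<And>z. z \<in> Z \<Longrightarrow> \<delta> \<le> f z"
proof (cases "Z = {}")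
  case True
  then show ?thesis using that[of 1] G by (auto simp: level_range_def)
next
  case False
  with continuous_attains_inf[OF assms(2) False assms(3)] assms(4) that show ?thesis by blast
qed

text \<open>For \<open>G = {0<..}\<close> the threshold is 0. For \<open>G = {0..}\<close> it must be negative; it exists because \<open>f\<close>
attains its maximum on the compact part of the region, and is at most \<open>a < 0\<close> on the rest.\<close>

lemma level_upper_bound:
  fixes f :: "real^2 \<Rightarrow> real"
  assumes G: "level_range G" and "continuous_on UNIV f" "a < 0"
    and far: "\<And>x. R1 \<le> norm x \<Longrightarrow> f x \<le> a" and neg: "\<And>x. r \<le> dist c x \<Longrightarrow> f x \<notin> G"
  obtains \<theta> where "\<theta> \<notin> G" "a \<le> \<theta>" "\<And>x. r \<le> dist c x \<Longrightarrow> f x \<le> \<theta>"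
proof (cases "G = {0<..}")
  case True
  then show ?thesis using neg assms(3) by (intro that[of 0]) (auto simp: not_less)
next
  case False
  with G have G0: "G = {0..}" by (auto simp: level_range_def)
  define Z where "Z = cball 0 R1 - ball c r"
  have Z: "compact Z" unfolding Z_def by (intro compact_diff) auto
  show ?thesis
  proof (cases "Z = {}")
    case True
    have "f x \<le> a" if "r \<le> dist c x" for x
    proof (rule far)
      have "x \<notin> cball 0 R1" using that True unfolding Z_def by (auto simp: subset_iff)
      then show "R1 \<le> norm x" by simp
    qed
    then show ?thesis using assms(3) G0 by (intro that[of a]) auto
  next
    case False
    obtain z where z: "z \<in> Z" "\<And>x. x \<in> Z \<Longrightarrow> f x \<le> f z"
      using continuous_attains_sup[OF Z False continuous_on_subset[OF assms(2)]] by blast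
    have "f z < 0" using neg[of z] z(1) G0 by (auto simp: Z_def)
    moreover have "f x \<le> max a (f z)" if "r \<le> dist c x" for x
    proof (cases "R1 \<le> norm x")
      case True
      then show ?thesis using far[of x] by simp
    next
      case False
      then have "x \<in> Z" using that by (auto simp: Z_def)
      then show ?thesis using z(2)[of x] by simp
    qed
    ultimately show ?thesis using assms(3) G0 by (intro that[of "max a (f z)"]) auto
  qed
qed

lemma obstacle_solutionD:
  assumes "obstacle_solution 0 \<Psi>m \<Psi>p u0 u"
  shows "continuous_on spacetime u" "continuous_on S \<Psi>m" "continuous_on S \<Psi>p"
    and "(\<And>x. x \<in> C \<Longrightarrow> \<Psi>m x \<le> \<theta>) \<Longrightarrow> curvature_subflow \<theta> C u"
    and "(\<And>x. x \<in> C \<Longrightarrow> - \<theta> \<le> \<Psi>p x) \<Longrightarrow> curvature_subflow \<theta> C (\<lambda>z. - u z)"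
    and "t > 0 \<Longrightarrow> \<Psi>m x \<le> u (x, t)"
    and "\<exists>a<0. \<forall>T>0. \<exists>R>0. \<forall>x t. R \<le> norm x \<and> 0 \<le> t \<and> t \<le> T \<longrightarrow> u (x, t) = a"
proof -
  have sub: "viscosity_subsolution 0 \<Psi>m \<Psi>p u0 u" and super: "viscosity_supersolution 0 \<Psi>m \<Psi>p u0 u"
    using assms by (auto simp: obstacle_solution_def viscosity_solution_def)
  show cont: "continuous_on spacetime u"
    using assms by (auto simp: obstacle_solution_def K_class_def)
  show "continuous_on S \<Psi>m" "continuous_on S \<Psi>p"
    using assms unfolding obstacle_solution_def
    by (meson lipschitz_on_continuous_on continuous_on_subset subset_UNIV)+
  show "(\<And>x. x \<in> C \<Longrightarrow> \<Psi>m x \<le> \<theta>) \<Longrightarrow> curvature_subflow \<theta> C u"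
    using subsolution_curvature_subflow[OF sub cont] by blast
  show "(\<And>x. x \<in> C \<Longrightarrow> - \<theta> \<le> \<Psi>p x) \<Longrightarrow> curvature_subflow \<theta> C (\<lambda>z. - u z)"
    using supersolution_curvature_subflow[OF super cont] by blast
  show "\<exists>a<0. \<forall>T>0. \<exists>R>0. \<forall>x t. R \<le> norm x \<and> 0 \<le> t \<and> t \<le> T \<longrightarrow> u (x, t) = a"
    using assms unfolding obstacle_solution_def K_class_def by blast
  assume t: "t > 0"
  have "ereal (\<Psi>m x) \<le> lsc_env spacetime u (x, t)"
    using super t unfolding viscosity_supersolution_def by blast
  then show "\<Psi>m x \<le> u (x, t)"
    using env_eq_continuous(2)[OF cont, of t x] t by simp
qed

lemma curvature_subflow_mono: "curvature_subflow \<theta> C v \<Longrightarrow> C' \<subseteq> C \<Longrightarrow> curvature_subflow \<theta> C' v"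
  unfolding curvature_subflow_def using interior_mono[of C' C] by blast

lemma continuous_on_window:
  "continuous_on spacetime v \<Longrightarrow> continuous_on (C \<times> {0..T}) v"
  by (rule continuous_on_subset) (auto simp: spacetime_def)

section \<open>The upper limit\<close>

text \<open>The barrier is used in the annulus between the disc of radius \<open>R\<close>, outside of which the obstacle is
inactive, and a circle so large that \<open>u\<close> is constant and negative there until the time \<open>T + 1\<close>.\<close>

lemma confined_to_disc:
  fixes c :: "real^2"
  assumes sol: "obstacle_solution 0 \<Psi>m \<Psi>p u0 u" and G: "level_range G" and R: "0 \<le> R" 
    and obst: "\<And>x. R \<le> dist c x \<Longrightarrow> \<Psi>m x \<notin> G"
    and init: "\<And>x. R0 \<le> dist c x \<Longrightarrow> u (x, 0) \<notin> G" and "0 \<le> R0"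
    and T: "0 \<le> T" "R0\<^sup>2 \<le> R\<^sup>2 + 2 * T" and x1: "R < dist c x1"
  shows "u (x1, T) \<notin> G"
proof -
  note cont = obstacle_solutionD(1)[OF sol]
  obtain a where a: "a < 0"
    "\<And>T. T > 0 \<Longrightarrow> \<exists>R>0. \<forall>x t. R \<le> norm x \<and> 0 \<le> t \<and> t \<le> T \<longrightarrow> u (x, t) = a"
    using obstacle_solutionD(7)[OF sol] by blast
  obtain R1 where R1: "\<And>x t. R1 \<le> norm x \<Longrightarrow> 0 \<le> t \<Longrightarrow> t \<le> T + 1 \<Longrightarrow> u (x, t) = a"
    using a(2)[of "T + 1"] T by auto
  have "\<Psi>m x \<le> a" if "R1 \<le> norm x" for x
    using obstacle_solutionD(6)[OF sol, of "T + 1" x] R1[OF that, of "T + 1"] T by simp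
  from level_upper_bound[OF G obstacle_solutionD(2)[OF sol] a(1) this obst]
  obtain \<theta>1 where \<theta>1: "\<theta>1 \<notin> G" "a \<le> \<theta>1" "\<And>x. R \<le> dist c x \<Longrightarrow> \<Psi>m x \<le> \<theta>1" by blast
  have "continuous_on UNIV (\<lambda>x. u (x, 0))"
    by (intro continuous_on_compose2[OF cont] continuous_intros) (auto simp: spacetime_def)
  from level_upper_bound[OF G this a(1) _ init]
  obtain \<theta>2 where \<theta>2: "\<theta>2 \<notin> G" "\<And>x. R0 \<le> dist c x \<Longrightarrow> u (x, 0) \<le> \<theta>2"
    using R1[of _ 0] T by (metis order.refl add_nonneg_nonneg zero_le_one)
  define \<theta> where "\<theta> = max \<theta>1 \<theta>2"
  define R2 where "R2 = max (dist c x1) (\<bar>R1\<bar> + norm c)"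
  define C where "C = cball c R2 - ball c R"
  have "u (x1, T) \<le> \<theta>"
  proof (rule subflow_confined_to_disc[of C])
    show "compact C" unfolding C_def by (intro compact_diff) auto
    show "continuous_on (C \<times> {0..T + 1}) u" by (rule continuous_on_window[OF cont])
    show "curvature_subflow \<theta> C u"
    proof (rule obstacle_solutionD(4)[OF sol])
      fix x assume "x \<in> C"
      then have "R \<le> dist c x" by (simp add: C_def not_less)
      then show "\<Psi>m x \<le> \<theta>" using \<theta>1(3)[of x] by (simp add: \<theta>_def)
    qed
    show "u (x, 0) \<le> \<theta>" if "x \<in> C" "R\<^sup>2 + 2 * T \<le> (dist c x)\<^sup>2" for x
    proof -
      have "R0\<^sup>2 \<le> (dist c x)\<^sup>2" using that T by simp
      then have "R0 \<le> dist c x" by (rule power2_le_imp_le) simp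
      then show ?thesis using \<theta>2(2)[of x] by (simp add: \<theta>_def)
    qed
    show "\<forall>t\<in>{0..T + 1}. u (x, t) \<le> \<theta>"
      if x: "x \<in> C" "x \<notin> interior C" "R < dist c x" for x
    proof -
      have "ball c R2 - cball c R \<subseteq> interior C"
        by (intro interior_maximal) (auto simp: C_def)
      with x(2) have "x \<notin> ball c R2 - cball c R" by (rule contra_subsetD[rotated])
      with x(3) have "R2 \<le> dist c x" by simp
      then have "\<bar>R1\<bar> + norm c \<le> norm (c - x)" by (simp add: R2_def dist_norm)
      then have "R1 \<le> norm x"
        using norm_triangle_ineq4[of c x] by linarith
      then show ?thesis using R1[of x] \<theta>1(2) by (auto simp: \<theta>_def)
    qed
    show "x1 \<in> C" using x1 by (auto simp: C_def R2_def)
  qed (use x1 R T in auto)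
  moreover have "\<theta> \<notin> G" using \<theta>1(1) \<theta>2(1) by (simp add: \<theta>_def max_def)
  ultimately show ?thesis using level_range_mono[OF G] by blast
qed

text \<open>A separating half-plane is replaced by a disc whose centre is far away from \<open>x\<close>, in the direction
normal to the boundary of the half-plane.\<close>

lemma exists_disc_separating:
  fixes K :: "'a::euclidean_space set"
  assumes K: "closed K" "convex K" "bounded K" "K \<noteq> {}" and x: "x \<notin> K"
  obtains c R where "0 \<le> R" "K \<subseteq> cball c R" "R < dist c x"
proof -
  obtain n b where n: "n \<bullet> x < b" "\<And>y. y \<in> K \<Longrightarrow> b < n \<bullet> y"
    using separating_hyperplane_closed_point[OF K(2,1) x] by blast
  define g where "g = b - n \<bullet> x"
  have g: "g > 0" using n by (simp add: g_def)
  obtain Q where Q: "\<And>y. y \<in> K \<Longrightarrow> dist x y \<le> Q"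
    using K(3) bounded_any_center[of K x] by auto
  \<comment> \<open>Moving the centre by \<open>l *\<^sub>R n\<close> gains \<open>2 * l * g\<close> in the squared distances of \<open>x\<close> and the points
    of \<open>K\<close>, and may lose \<open>Q\<^sup>2\<close>; the choice of \<open>l\<close> makes the gain prevail.\<close>
  define l where "l = (Q\<^sup>2 + 1) / g"
  have l: "l > 0" using g by (simp add: l_def add_nonneg_pos)
  define c where "c = x + l *\<^sub>R n"
  define q where "q = (l * norm n)\<^sup>2 - l * g"
  have est: "(dist c y)\<^sup>2 \<le> q" if y: "y \<in> K" for y
  proof -
    have "(dist c y)\<^sup>2 = (norm (y - x))\<^sup>2 - 2 * (l * (n \<bullet> (y - x))) + (l * norm n)\<^sup>2"
    proof -
      have expand: "(norm (l *\<^sub>R n - d))\<^sup>2 = (norm d)\<^sup>2 - 2 * (l * (n \<bullet> d)) + (l * norm n)\<^sup>2" for d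
        unfolding power_mult_distrib power2_norm_eq_inner
        by (simp add: inner_diff_left inner_diff_right inner_commute power2_eq_square algebra_simps)
      have "c - y = l *\<^sub>R n - (y - x)" by (simp add: c_def)
      then show ?thesis unfolding dist_norm using expand[of "y - x"] by (simp only:)
    qed
    moreover have "l * (n \<bullet> (y - x)) \<ge> l * g"
      using n(2)[OF y] l by (intro mult_left_mono) (auto simp: g_def inner_diff_right)
    moreover have "(norm (y - x))\<^sup>2 \<le> Q\<^sup>2"
      using Q[OF y] by (intro power_mono) (auto simp: dist_norm norm_minus_commute)
    moreover have "l * g = Q\<^sup>2 + 1" using g by (simp add: l_def)
    ultimately show ?thesis unfolding q_def by linarith
  qed
  obtain y where "y \<in> K" using K(4) by blast
  then have q: "0 \<le> q" using est zero_le_power2[of "dist c y"] by (meson order_trans)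
  show ?thesis
  proof
    show "0 \<le> sqrt q" using q by simp
    show "K \<subseteq> cball c (sqrt q)" using real_le_rsqrt[OF est] by auto
    have "q < (l * norm n)\<^sup>2" using l g by (simp add: q_def)
    then have "sqrt q < sqrt ((l * norm n)\<^sup>2)" by (rule real_sqrt_less_mono)
    also have "\<dots> = dist c x" using l by (simp add: c_def dist_norm)
    finally show "sqrt q < dist c x" .
  qed
qed

lemma upper_limit_subset_hull:
  fixes D :: "real \<Rightarrow> (real^2) set"
  assumes sol: "obstacle_solution 0 \<Psi>m \<Psi>p u0 u" and G: "level_range G"
    and D: "\<And>t. 0 \<le> t \<Longrightarrow> D t = {x. u (x, t) \<in> G}"
    and K: "closed K" "convex K" "bounded K" "K \<noteq> {}" "{x. \<Psi>m x \<in> G} \<subseteq> K"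
    and bdd: "bounded (D 0)"
  shows "upper_limit D \<subseteq> K"
proof
  fix x assume x: "x \<in> upper_limit D"
  show "x \<in> K"
  proof (rule ccontr)
    assume "x \<notin> K"
    then obtain c R where cR: "0 \<le> R" "K \<subseteq> cball c R" "R < dist c x"
      using exists_disc_separating[OF K(1-4)] by metis
    obtain R0 where R0: "D 0 \<subseteq> ball c R0" "0 < R0"
      using bounded_subset_ballD[OF bdd, of c] by blast
    \<comment> \<open>A radius strictly between, so that the circle of radius \<open>R'\<close> does not meet \<open>K\<close>.\<close>
    define R' where "R' = (R + dist c x) / 2"
    have R': "R < R'" "R' < dist c x" "0 \<le> R'" using cR by (auto simp: R'_def)
    define \<tau> where "\<tau> = R0\<^sup>2 + 1"
    have "\<tau> > 0" by (simp add: \<tau>_def add_nonneg_pos)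
    then obtain t where t: "t > \<tau>" "x \<in> D t" using x unfolding upper_limit_def by blast
    then have t0: "0 \<le> t" using \<open>\<tau> > 0\<close> by simp
    have "u (x, t) \<notin> G"
    proof (rule confined_to_disc[OF sol G R'(3)])
      show "\<Psi>m y \<notin> G" if "R' \<le> dist c y" for y
      proof
        assume "\<Psi>m y \<in> G"
        then have "y \<in> cball c R" using K(5) cR(2) by blast
        then show False using that R'(1) by simp
      qed
      show "u (y, 0) \<notin> G" if "R0 \<le> dist c y" for y
      proof
        assume "u (y, 0) \<in> G"
        then have "y \<in> ball c R0" using D[of 0] R0(1) by blast
        then show False using that by simp
      qed
      have "R0\<^sup>2 \<ge> 0" "R'\<^sup>2 \<ge> 0" by auto
      then show "R0\<^sup>2 \<le> R'\<^sup>2 + 2 * t" using t(1) unfolding \<tau>_def by linarith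
    qed (use R0 t0 R' in auto)
    then show False using D[OF t0] t(2) by simp
  qed
qed

section \<open>Segments that stay covered\<close>

lemma plane_frame:
  fixes e :: "real^2"
  assumes "norm e = 1"
  obtains n where "n \<bullet> n = 1" "n \<bullet> e = 0" "\<And>y. y = (y \<bullet> e) *\<^sub>R e + (y \<bullet> n) *\<^sub>R n"
    "\<And>y. (norm y)\<^sup>2 = (y \<bullet> e)\<^sup>2 + (y \<bullet> n)\<^sup>2"
proof
  define n :: "real^2" where "n = vector [- e$2, e$1]"
  have ee: "e$1 * e$1 + e$2 * e$2 = 1" using assms norm_square_2[of e] by simp
  then show n: "n \<bullet> n = 1" "n \<bullet> e = 0"
    by (simp_all add: n_def inner_vec_def sum_2)
  show dec: "y = (y \<bullet> e) *\<^sub>R e + (y \<bullet> n) *\<^sub>R n" for y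
  proof -
    have "y$1 = y$1 * (e$1 * e$1 + e$2 * e$2)" "y$2 = y$2 * (e$1 * e$1 + e$2 * e$2)"
      using ee by simp_all
    then show ?thesis
      by (simp add: vec_eq_iff forall_2 inner_vec_def sum_2 n_def algebra_simps)
  qed
  show "(norm y)\<^sup>2 = (y \<bullet> e)\<^sup>2 + (y \<bullet> n)\<^sup>2" for y
  proof -
    have "y \<bullet> y = y \<bullet> ((y \<bullet> e) *\<^sub>R e + (y \<bullet> n) *\<^sub>R n)" using dec[of y] by simp
    then show ?thesis
      unfolding power2_norm_eq_inner by (simp add: inner_add_right power2_eq_square)
  qed
qed

text \<open>The comparison takes place in the rectangle of half-width \<open>\<rho>\<close> along the segment. On the two long
sides the quartic barrier has grown to a bound for \<open>v\<close>; the short sides lie in the discs around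
\<open>a\<close> and \<open>b\<close>.\<close>

lemma segment_persists_barrier:
  fixes a b :: "real^2"
  assumes ab: "a \<noteq> b" and \<rho>: "0 < \<rho>" and T: "0 \<le> T"
    and N: "\<And>z. z \<in> closed_segment a b \<Longrightarrow> cball z \<rho> \<subseteq> N"
    and cont: "continuous_on spacetime v" and sub: "curvature_subflow \<theta> N v"
    and init: "\<And>x. x \<in> N \<Longrightarrow> v (x, 0) \<le> \<theta>"
    and ends: "\<And>x t. x \<in> cball a \<rho> \<union> cball b \<rho> \<Longrightarrow> 0 \<le> t \<Longrightarrow> t \<le> T + 1 \<Longrightarrow> v (x, t) \<le> \<theta>"
    and z: "z \<in> closed_segment a b"
  shows "v (z, T) \<le> \<theta>"
proof -
  define L where "L = norm (b - a)"
  have L: "L > 0" using ab by (simp add: L_def)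
  define e where "e = (1 / L) *\<^sub>R (b - a)"
  have norm_e: "norm e = 1" using L by (simp add: e_def L_def)
  then have e: "e \<bullet> e = 1" by (simp add: norm_eq_1)
  obtain n where n: "n \<bullet> n = 1" "n \<bullet> e = 0"
    and frame: "\<And>y. y = (y \<bullet> e) *\<^sub>R e + (y \<bullet> n) *\<^sub>R n"
    using plane_frame[OF norm_e] by metis
  have dec: "x = a + ((x - a) \<bullet> e) *\<^sub>R e + ((x - a) \<bullet> n) *\<^sub>R n" for x
    using frame[of "x - a"] by (simp add: algebra_simps)
  have bL: "b = a + L *\<^sub>R e" using L by (simp add: e_def)
  define Q where "Q = {x. 0 \<le> (x - a) \<bullet> e \<and> (x - a) \<bullet> e \<le> L \<and> - \<rho> \<le> (x - a) \<bullet> n \<and> (x - a) \<bullet> n \<le> \<rho>}"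
  have near: "dist (a + ((x - a) \<bullet> e) *\<^sub>R e) x = \<bar>(x - a) \<bullet> n\<bar>" for x
  proof -
    have "x - (a + ((x - a) \<bullet> e) *\<^sub>R e) = ((x - a) \<bullet> n) *\<^sub>R n"
      using dec[of x] by (simp add: algebra_simps)
    then show ?thesis using n by (metis dist_norm norm_minus_commute norm_scaleR norm_eq_1 mult.right_neutral)
  qed
  have seg: "a + s *\<^sub>R e \<in> closed_segment a b" if "0 \<le> s" "s \<le> L" for s
    unfolding in_segment using that L
    by (intro exI[of _ "s / L"]) (simp add: e_def L_def algebra_simps)
  have QN: "Q \<subseteq> N"
  proof
    fix x assume x: "x \<in> Q"
    then have "x \<in> cball (a + ((x - a) \<bullet> e) *\<^sub>R e) \<rho>" using near[of x] by (auto simp: Q_def)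
    moreover have "cball (a + ((x - a) \<bullet> e) *\<^sub>R e) \<rho> \<subseteq> N"
      by (intro N seg) (use x in \<open>auto simp: Q_def\<close>)
    ultimately show "x \<in> N" by blast
  qed
  have "bounded Q"
  proof -
    have "dist a x \<le> L + \<rho>" if "x \<in> Q" for x
    proof -
      have "dist a (a + ((x - a) \<bullet> e) *\<^sub>R e) = \<bar>(x - a) \<bullet> e\<bar>"
        using e by (simp add: dist_norm norm_eq_1)
      then show ?thesis
        using dist_triangle[of a x "a + ((x - a) \<bullet> e) *\<^sub>R e"] near[of x] that by (auto simp: Q_def)
    qed
    then show ?thesis unfolding bounded_def by blast
  qed
  moreover have "closed Q"
    unfolding Q_def by (intro closed_Collect_conj closed_Collect_le continuous_intros)
  ultimately have Q: "compact Q" by (simp add: compact_eq_bounded_closed)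
  have int: "x \<in> interior Q" if "0 < (x - a) \<bullet> e" "(x - a) \<bullet> e < L" "- \<rho> < (x - a) \<bullet> n" "(x - a) \<bullet> n < \<rho>" for x
  proof -
    let ?O = "{x. 0 < (x - a) \<bullet> e \<and> (x - a) \<bullet> e < L \<and> - \<rho> < (x - a) \<bullet> n \<and> (x - a) \<bullet> n < \<rho>}"
    have "open ?O"
      by (intro open_Collect_conj open_Collect_less continuous_intros)
    then have "?O \<subseteq> interior Q" by (intro interior_maximal) (auto simp: Q_def)
    then show ?thesis using that by auto
  qed
  obtain s where s: "0 \<le> s" "s \<le> L" "z = a + s *\<^sub>R e"
  proof -
    obtain u where "0 \<le> u" "u \<le> 1" "z = a + u *\<^sub>R (b - a)"
      using z by (auto simp: in_segment algebra_simps)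
    then show ?thesis using L
      by (intro that[of "u * L"]) (auto simp: e_def mult_le_cancel_right1)
  qed
  have zQ: "z \<in> Q" and zn: "(z - a) \<bullet> n = 0"
    using s e n \<rho> by (auto simp: Q_def inner_commute)
  have comp: "compact (Q \<times> {0..T+1})" using Q by (intro compact_Times) auto
  have contQ: "continuous_on (Q \<times> {0..T+1}) v" by (rule continuous_on_window[OF cont])
  obtain zM where zM: "\<And>z. z \<in> Q \<times> {0..T+1} \<Longrightarrow> v z \<le> v zM"
    using continuous_attains_sup[OF comp _ contQ] zQ T by fastforce
  define M where "M = max 1 (v zM - \<theta>)"
  define A where "A = M / \<rho> ^ 4"
  have A: "A > 0" using \<rho> by (simp add: A_def M_def)
  define w where "w = (\<lambda>z::(real^2) \<times> real. \<theta> + A * ((fst z - a) \<bullet> n) ^ 4)"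
  have w\<theta>: "w z \<ge> \<theta>" for z using A by (simp add: w_def)
  have nn: "norm n = 1" using n by (simp add: norm_eq_1)
  have "v (z, T) \<le> w (z, T)"
  proof (rule curvature_comparison[where T'="T + 1" and C=Q and \<theta>=\<theta>])
    show "curvature_subflow \<theta> Q v" by (rule curvature_subflow_mono[OF sub QN])
    show "elementary w" unfolding w_def by (rule strip_barrier[OF nn A])
    fix x t assume x: "x \<in> Q" and t: "0 \<le> t" "t \<le> T + 1"
    have curv: "curvature_ge (space_grad w (x, t)) (space_hess w (x, t)) (- time_deriv w (x, t))"
      unfolding w_def by (rule strip_barrier[OF nn A])
    consider "t = 0" | "(x - a) \<bullet> e = 0" | "(x - a) \<bullet> e = L" | "\<bar>(x - a) \<bullet> n\<bar> = \<rho>"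
      | "0 < t" "x \<in> interior Q"
      using x t int[of x] by (fastforce simp: Q_def)
    then show "v (x, t) \<le> w (x, t) \<or> x \<in> interior Q \<and> 0 < t \<and> \<theta> \<le> w (x, t) \<and>
      curvature_ge (space_grad w (x, t)) (space_hess w (x, t)) (- time_deriv w (x, t))"
    proof cases
      case 1
      then show ?thesis using init[of x] x QN w\<theta>[of "(x, t)"] by force
    next
      case 2
      then have "x \<in> cball a \<rho>" using near[of x] x by (auto simp: Q_def)
      then show ?thesis using ends[of x t] t w\<theta>[of "(x, t)"] by force
    next
      case 3
      then have "x \<in> cball b \<rho>" using near[of x] x bL by (auto simp: Q_def)
      then show ?thesis using ends[of x t] t w\<theta>[of "(x, t)"] by force
    next
      case 4
      have "((x - a) \<bullet> n) ^ 4 = \<rho> ^ 4" using 4 by (metis power_even_abs even_numeral)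
      then have "w (x, t) = \<theta> + M" using \<rho> by (simp add: w_def A_def)
      moreover have "v (x, t) \<le> \<theta> + M" using zM[of "(x, t)"] x t by (auto simp: M_def)
      ultimately show ?thesis by simp
    next
      case 5
      then show ?thesis using curv w\<theta> by blast
    qed
  qed (use Q T contQ zQ in auto)
  then show ?thesis by (simp add: w_def zn)
qed

text \<open>The strip barrier acts on the complement \<open>{-u > -\<delta>}\<close>. For the open evolution \<open>\<delta>\<close> is a positive
lower bound of \<open>u\<close> and of the upper obstacle on the compact sets involved.\<close>

lemma segment_persists:
  fixes Om D0 :: "(real^2) set"
  assumes sol: "obstacle_solution 0 \<Psi>m \<Psi>p u0 u" and G: "level_range G" and \<Psi>p: "\<And>x. \<Psi>p x \<in> G"
    and "open Om" and Om: "\<And>x t. x \<in> Om \<Longrightarrow> 0 \<le> t \<Longrightarrow> u (x, t) \<in> G"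
    and "open D0" and D0: "\<And>x. x \<in> D0 \<Longrightarrow> u (x, 0) \<in> G"
    and ab: "a \<in> Om" "b \<in> Om" "closed_segment a b \<subseteq> D0" and z: "z \<in> closed_segment a b"
    and T: "0 \<le> T"
  shows "u (z, T) \<in> G"
proof (cases "a = b")
  case True
  then show ?thesis using z ab Om T by auto
next
  case False
  note cont = obstacle_solutionD(1)[OF sol]
  obtain \<rho>1 where \<rho>1: "\<rho>1 > 0" "cball a \<rho>1 \<subseteq> Om"
    using \<open>open Om\<close> ab(1) open_contains_cball by blast
  obtain \<rho>2 where \<rho>2: "\<rho>2 > 0" "cball b \<rho>2 \<subseteq> Om"
    using \<open>open Om\<close> ab(2) open_contains_cball by blast
  obtain \<rho>3 where \<rho>3: "\<rho>3 > 0" "(\<Union>z\<in>closed_segment a b. cball z \<rho>3) \<subseteq> D0"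
    using compact_subset_open_imp_cball_epsilon_subset[OF compact_segment \<open>open D0\<close> ab(3)] by blast
  define \<rho> where "\<rho> = min \<rho>1 (min \<rho>2 \<rho>3)"
  have \<rho>: "\<rho> > 0" using \<rho>1 \<rho>2 \<rho>3 by (simp add: \<rho>_def)
  define N where "N = (\<lambda>(x, y). x + y) ` (closed_segment a b \<times> cball 0 \<rho>)"
  have N1: "cball z \<rho> \<subseteq> N" if "z \<in> closed_segment a b" for z
  proof
    fix x assume "x \<in> cball z \<rho>"
    then have "(z, x - z) \<in> closed_segment a b \<times> cball 0 \<rho>"
      using that by (simp add: dist_norm norm_minus_commute)
    then show "x \<in> N" unfolding N_def by (rule rev_image_eqI) simp
  qed
  have "compact N"
    unfolding N_def case_prod_unfold
    by (intro compact_continuous_image continuous_intros compact_Times compact_segment compact_cball)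
  moreover have "N \<subseteq> D0"
  proof
    fix x assume "x \<in> N"
    then obtain z y where "z \<in> closed_segment a b" "norm y \<le> \<rho>" "x = z + y"
      by (auto simp: N_def)
    then have "x \<in> (\<Union>z\<in>closed_segment a b. cball z \<rho>3)"
      by (intro UN_I[of z]) (auto simp: \<rho>_def dist_norm)
    with \<rho>3(2) show "x \<in> D0" by blast
  qed
  ultimately have N: "compact N" "N \<subseteq> D0" .
  define B where "B = cball a \<rho> \<union> cball b \<rho>"
  have BO: "B \<subseteq> Om" using \<rho>1 \<rho>2 unfolding B_def \<rho>_def by force
  have "continuous_on (N \<times> {0}) u" "continuous_on (B \<times> {0..T+1}) u"
    by (auto intro!: continuous_on_subset[OF cont] simp: spacetime_def)
  moreover have "compact (N \<times> {0::real})" "compact (B \<times> {0..T+1})"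
    using N by (auto intro!: compact_Times simp: B_def)
  ultimately have comp: "compact (N \<times> {0::real})" "continuous_on (N \<times> {0}) u"
      "compact (B \<times> {0..T+1})" "continuous_on (B \<times> {0..T+1}) u" by auto
  obtain \<delta>1 where \<delta>1: "\<delta>1 \<in> G" "\<And>z. z \<in> N \<times> {0} \<Longrightarrow> \<delta>1 \<le> u z"
    by (rule level_compact_lower[OF G comp(1,2)]) (use D0 N(2) in auto)
  obtain \<delta>2 where \<delta>2: "\<delta>2 \<in> G" "\<And>z. z \<in> B \<times> {0..T+1} \<Longrightarrow> \<delta>2 \<le> u z"
    by (rule level_compact_lower[OF G comp(3,4)]) (use Om BO in auto)
  obtain \<delta>3 where \<delta>3: "\<delta>3 \<in> G" "\<And>z. z \<in> N \<Longrightarrow> \<delta>3 \<le> \<Psi>p z"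
    by (rule level_compact_lower[OF G N(1) obstacle_solutionD(3)[OF sol]]) (use \<Psi>p in auto)
  define \<delta> where "\<delta> = min \<delta>1 (min \<delta>2 \<delta>3)"
  have "\<delta> \<in> G" using \<delta>1(1) \<delta>2(1) \<delta>3(1) by (simp add: \<delta>_def min_def)
  have "- u (z, T) \<le> - \<delta>"
  proof (rule segment_persists_barrier[OF False \<rho> T _ _ _ _ _ z, of N])
    show "cball z \<rho> \<subseteq> N" if "z \<in> closed_segment a b" for z by (rule N1[OF that])
    show "continuous_on spacetime (\<lambda>z. - u z)" by (intro continuous_on_minus cont)
    show "curvature_subflow (- \<delta>) N (\<lambda>z. - u z)"
      using \<delta>3(2) by (intro obstacle_solutionD(5)[OF sol]) (force simp: \<delta>_def)
    show "- u (x, 0) \<le> - \<delta>" if "x \<in> N" for x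
      using \<delta>1(2)[of "(x, 0)"] that by (auto simp: \<delta>_def)
    show "- u (x, t) \<le> - \<delta>" if "x \<in> cball a \<rho> \<union> cball b \<rho>" "0 \<le> t" "t \<le> T + 1" for x t
      using \<delta>2(2)[of "(x, t)"] that unfolding B_def[symmetric] by (auto simp: \<delta>_def)
  qed
  then show ?thesis using level_range_mono[OF G \<open>\<delta> \<in> G\<close>] by simp
qed

section \<open>Topology of the plane\<close>

definition cross :: "real^2 \<Rightarrow> real^2 \<Rightarrow> real" where
  "cross x y = x$1 * y$2 - x$2 * y$1"

lemma continuous_on_cross [continuous_intros]:
  "continuous_on A f \<Longrightarrow> continuous_on A g \<Longrightarrow> continuous_on A (\<lambda>z. cross (f z) (g z))"
  unfolding cross_def by (intro continuous_intros)

lemma opposite_in_segment: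
  fixes p :: "'a::real_vector"
  assumes "\<alpha> *\<^sub>R (a - p) + \<beta> *\<^sub>R (b - p) = 0" "0 \<le> \<alpha>" "0 \<le> \<beta>" "0 < \<alpha> + \<beta>"
  shows "p \<in> closed_segment a b"
proof -
  define s where "s = \<beta> / (\<alpha> + \<beta>)"
  have s: "0 \<le> s" "s \<le> 1" "1 - s = \<alpha> / (\<alpha> + \<beta>)" using assms by (auto simp: s_def field_simps)
  have "(\<alpha> + \<beta>) *\<^sub>R p = \<alpha> *\<^sub>R a + \<beta> *\<^sub>R b" using assms(1) by (simp add: algebra_simps)
  then have "(1 / (\<alpha> + \<beta>)) *\<^sub>R ((\<alpha> + \<beta>) *\<^sub>R p) = (1 / (\<alpha> + \<beta>)) *\<^sub>R (\<alpha> *\<^sub>R a + \<beta> *\<^sub>R b)" by simp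
  then have "p = (1 - s) *\<^sub>R a + s *\<^sub>R b"
    using assms(4) unfolding s(3) by (simp add: s_def scaleR_add_right)
  with s show ?thesis unfolding in_segment by blast
qed

text \<open>The rays from \<open>p\<close> opposite to \<open>b\<close> and to \<open>c\<close> together form a broken line that separates \<open>a\<close> from
\<open>b\<close>. The connected set \<open>S\<close> meets it, and a point of \<open>S\<close> on such a ray has \<open>p\<close> between itself and
\<open>b\<close> or \<open>c\<close>. The functions \<open>f\<close> and \<open>g\<close> are, up to a positive factor, the coordinates with respect to
\<open>a - p\<close> and \<open>b - p\<close>.\<close>

lemma triangle_point_between_two:
  assumes S: "connected S" "a \<in> S" "b \<in> S" "c \<in> S"
    and sum: "u *\<^sub>R (a - p) + v *\<^sub>R (b - p) + w *\<^sub>R (c - p) = 0" "0 < u" "0 < v" "0 < w"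
    and d: "0 < cross (a - p) (b - p)"
  shows "\<exists>q1\<in>S. \<exists>q2\<in>S. p \<in> closed_segment q1 q2"
proof -
  define d where "d = cross (u *\<^sub>R (a - p)) (v *\<^sub>R (b - p))"
  have "d = u * v * cross (a - p) (b - p)" by (simp add: d_def cross_def algebra_simps)
  then have d: "d > 0" using d sum by simp
  define f where "f = (\<lambda>z. cross (z - p) (v *\<^sub>R (b - p)))"
  define g where "g = (\<lambda>z. cross (u *\<^sub>R (a - p)) (z - p))"
  have fg: "continuous_on UNIV f" "continuous_on UNIV g"
    unfolding f_def g_def by (intro continuous_intros)+
  have cramer: "d *\<^sub>R (z - p) = f z *\<^sub>R (u *\<^sub>R (a - p)) + g z *\<^sub>R (v *\<^sub>R (b - p))" for z
    by (simp add: vec_eq_iff forall_2 d_def f_def g_def cross_def algebra_simps)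
  let ?A = "{z. 0 < f z \<and> g z < f z}" and ?B = "{z. f z < 0 \<or> f z < g z}"
  have "open ?A" "open ?B"
    using fg by (auto intro!: open_Collect_conj open_Collect_disj open_Collect_less continuous_intros)
  moreover have "a \<in> ?A"
  proof -
    have "u * f a = d" "g a = 0" by (simp_all add: f_def g_def d_def cross_def algebra_simps)
    then show ?thesis using d sum by (auto simp: zero_less_mult_iff)
  qed
  moreover have "b \<in> ?B"
  proof -
    have "v * g b = d" "f b = 0" by (simp_all add: f_def g_def d_def cross_def algebra_simps)
    then show ?thesis using d sum by (auto simp: zero_less_mult_iff)
  qed
  ultimately have "\<not> S \<subseteq> ?A \<union> ?B"
    using S connectedD[OF S(1), of ?A ?B] by fastforce
  then obtain z where z: "z \<in> S" "z \<notin> ?A" "z \<notin> ?B" by blast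
  then consider "f z = 0" "g z \<le> 0" | "f z = g z" "0 \<le> g z" by fastforce
  then show ?thesis
  proof cases
    case 1
    have "d *\<^sub>R (z - p) + (- g z * v) *\<^sub>R (b - p) = 0"
      unfolding cramer using 1 by simp
    moreover have "0 \<le> - g z * v" using 1 sum by (intro mult_nonneg_nonneg) auto
    ultimately have "p \<in> closed_segment z b"
      using d by (intro opposite_in_segment[of d z p "- g z * v" b]) linarith+
    then show ?thesis using z S by blast
  next
    case 2
    have "u *\<^sub>R (a - p) + v *\<^sub>R (b - p) = - (w *\<^sub>R (c - p))"
      using sum(1) by (simp add: eq_neg_iff_add_eq_0)
    then have "g z *\<^sub>R (u *\<^sub>R (a - p) + v *\<^sub>R (b - p)) = g z *\<^sub>R (- (w *\<^sub>R (c - p)))" by simp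
    then have "d *\<^sub>R (z - p) + (g z * w) *\<^sub>R (c - p) = 0"
      unfolding cramer using 2 by (simp add: scaleR_add_right)
    moreover have "0 \<le> g z * w" using 2 sum by (intro mult_nonneg_nonneg) auto
    ultimately have "p \<in> closed_segment z c"
      using d by (intro opposite_in_segment[of d z p "g z * w" c]) linarith+
    then show ?thesis using z S by blast
  qed
qed

text \<open>By Caratheodory's theorem three points suffice; connectedness saves one more. The degenerate
triangles are those where a weight vanishes or the three points are collinear with \<open>p\<close>.\<close>

lemma connected_hull_two_points:
  fixes S :: "(real^2) set"
  assumes S: "connected S" and p: "p \<in> convex hull S"
  shows "\<exists>q1\<in>S. \<exists>q2\<in>S. p \<in> closed_segment q1 q2"
proof -
  obtain F where F: "finite F" "F \<subseteq> S" "card F \<le> 3" "p \<in> convex hull F"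
    using p unfolding caratheodory[of S] by auto
  have "F \<noteq> {}" using F(4) by auto
  then have "card F > 0" using F(1) by (simp add: card_gt_0_iff)
  then consider "card F = 1" | "card F = 2" | "card F = 3" using F(3) by linarith
  then obtain a b c where abc: "F = {a, b, c}"
  proof cases
    case 1
    then show ?thesis using that by (metis card_1_singletonE insert_absorb2)
  next
    case 2
    then show ?thesis using that by (metis card_2_iff insert_absorb2)
  next
    case 3
    then show ?thesis using that by (metis card_3_iff)
  qed
  have in_S: "a \<in> S" "b \<in> S" "c \<in> S" using F(2) abc by auto
  obtain u v w where uvw: "0 \<le> u" "0 \<le> v" "0 \<le> w" "u + v + w = 1"
    "p = u *\<^sub>R a + v *\<^sub>R b + w *\<^sub>R c"
    using F(4) unfolding abc convex_hull_3 by blast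
  have sum: "u *\<^sub>R (a - p) + v *\<^sub>R (b - p) + w *\<^sub>R (c - p) = 0"
  proof -
    have "u *\<^sub>R (a - p) + v *\<^sub>R (b - p) + w *\<^sub>R (c - p) = p - (u + v + w) *\<^sub>R p"
      by (subst (4) uvw(5)) (simp add: algebra_simps)
    then show ?thesis using uvw(4) by simp
  qed
  consider "u = 0" | "v = 0" | "w = 0" | "u > 0" "v > 0" "w > 0" using uvw by linarith
  then show ?thesis
  proof cases
    case 1
    then have "p \<in> closed_segment b c" using sum uvw by (intro opposite_in_segment[of v b p w c]) auto
    then show ?thesis using in_S by blast
  next
    case 2
    then have "p \<in> closed_segment a c" using sum uvw by (intro opposite_in_segment[of u a p w c]) auto
    then show ?thesis using in_S by blast
  next
    case 3
    then have "p \<in> closed_segment a b" using sum uvw by (intro opposite_in_segment[of u a p v b]) auto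
    then show ?thesis using in_S by blast
  next
    case pos: 4
    consider "cross (a - p) (b - p) > 0" | "cross (b - p) (a - p) > 0" | "cross (a - p) (b - p) = 0"
      by (auto simp: cross_def) (smt (verit) mult.commute)
    then show ?thesis
    proof cases
      case 1
      then show ?thesis using triangle_point_between_two[OF S in_S sum pos] by blast
    next
      case 2
      have "v *\<^sub>R (b - p) + u *\<^sub>R (a - p) + w *\<^sub>R (c - p) = 0" using sum by (simp add: add.commute)
      then show ?thesis using triangle_point_between_two[OF S in_S(2,1,3) _ pos(2,1,3) 2] by blast
    next
      case 3
      show ?thesis
      proof (cases "a = p")
        case True
        then show ?thesis using in_S by (intro bexI[of _ a]) auto
      next
        case False
        define x where "x = a - p"
        define y where "y = b - p"
        have x: "x \<bullet> x > 0" using False by (simp add: x_def)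
        define k where "k = (x \<bullet> y) / (x \<bullet> x)"
        have "(x \<bullet> x) *\<^sub>R y = (x \<bullet> y) *\<^sub>R x"
        proof -
          have "x$1 * y$2 = x$2 * y$1" using 3 by (simp add: cross_def x_def y_def)
          then show ?thesis
            by (simp add: vec_eq_iff forall_2 inner_vec_def sum_2 algebra_simps)
        qed
        then have "(1 / (x \<bullet> x)) *\<^sub>R ((x \<bullet> x) *\<^sub>R y) = (1 / (x \<bullet> x)) *\<^sub>R ((x \<bullet> y) *\<^sub>R x)" by simp
        then have y: "b - p = k *\<^sub>R (a - p)" using x by (simp add: k_def flip: x_def y_def)
        show ?thesis
        proof (cases "k \<le> 0")
          case True
          have "(- k) *\<^sub>R (a - p) + 1 *\<^sub>R (b - p) = 0" by (simp add: y)
          then have "p \<in> closed_segment a b" by (rule opposite_in_segment) (use True in auto)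
          then show ?thesis using in_S by blast
        next
          case False
          have "(u + v * k) *\<^sub>R (a - p) + w *\<^sub>R (c - p) = 0"
            using sum unfolding y by (simp add: algebra_simps)
          moreover have "0 < v * k" using False pos by simp
          ultimately have "p \<in> closed_segment a c"
            using pos by (intro opposite_in_segment[of "u + v * k" a p w c]) linarith+
          then show ?thesis using in_S by blast
        qed
      qed
    qed
  qed
qed

lemma connected_component_continuous_image:
  assumes "connected_component S a b" "continuous_on UNIV f"
  shows "connected_component (f ` S) (f a) (f b)"
proof -
  obtain T where "connected T" "T \<subseteq> S" "a \<in> T" "b \<in> T"
    using assms(1) by (auto simp: connected_component_def)
  then show ?thesis
    unfolding connected_component_def
    by (intro exI[of _ "f ` T"])
       (auto intro!: connected_continuous_image continuous_on_subset[OF assms(2)])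
qed

text \<open>Janiszewski's theorem, moved from the complex numbers along the obvious homeomorphism.\<close>

lemma Janiszewski_real2:
  fixes a b :: "real^2"
  assumes "compact S" "compact T" "connected (S \<inter> T)"
    "connected_component (- S) a b" "connected_component (- T) a b"
  shows "connected_component (- (S \<union> T)) a b"
proof -
  define f where "f = (\<lambda>x::real^2. Complex (x$1) (x$2))"
  define g where "g = (\<lambda>z. vector [Re z, Im z] :: real^2)"
  have gf: "g (f x) = x" for x by (simp add: f_def g_def vec_eq_iff forall_2)
  have fg: "f (g z) = z" for z by (simp add: f_def g_def)
  have f: "continuous_on A f" for A
    unfolding f_def by (intro continuous_intros)
  have g: "continuous_on A g" for A
  proof -
    have "g = (\<lambda>z. \<chi> i. if i = 1 then Re z else Im z)"
      by (simp add: g_def fun_eq_iff vec_eq_iff forall_2)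
    moreover have "continuous_on A (\<lambda>z. if i = 1 then Re z else Im z)" for i :: 2
      by (cases "i = 1") (auto intro: continuous_intros)
    ultimately show ?thesis by (simp add: continuous_on_vec_lambda)
  qed
  have bij: "bij f" by (rule o_bij[of g]) (auto simp: fun_eq_iff gf fg)
  have "connected_component (- (f ` S \<union> f ` T)) (f a) (f b)"
  proof (rule Janiszewski)
    show "compact (f ` S)" "closed (f ` T)"
      using assms(1,2) f by (auto intro!: compact_continuous_image compact_imp_closed)
    have "f ` S \<inter> f ` T = f ` (S \<inter> T)" using bij by (simp add: image_Int bij_is_inj)
    then show "connected (f ` S \<inter> f ` T)" using assms(3) f by (auto intro: connected_continuous_image)
    show "connected_component (- f ` S) (f a) (f b)" "connected_component (- f ` T) (f a) (f b)"
      using connected_component_continuous_image[OF assms(4) f]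
        connected_component_continuous_image[OF assms(5) f]
      by (simp_all add: bij_image_Compl_eq[OF bij])
  qed
  from connected_component_continuous_image[OF this g]
  have "connected_component (g ` (- (f ` S \<union> f ` T))) a b" by (simp add: gf)
  moreover have "g ` (- (f ` S \<union> f ` T)) \<subseteq> - (S \<union> T)"
    by (auto simp: fg) (metis fg image_eqI)+
  ultimately show ?thesis by (rule connected_component_of_subset)
qed

lemma rectangle_inside:
  fixes p e n :: "'a::euclidean_space"
  assumes "closed Z" and p: "p \<notin> Z" and l: "0 < l1" "0 < l2" "0 < r"
    and Q: "Q = {x. - l1 \<le> (x - p) \<bullet> e \<and> (x - p) \<bullet> e \<le> l2 \<and> - r \<le> (x - p) \<bullet> n \<and> (x - p) \<bullet> n \<le> r}"
    and "bounded Q"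
    and edges: "\<And>x. x \<in> Q \<Longrightarrow> (x - p) \<bullet> e = - l1 \<or> (x - p) \<bullet> e = l2 \<or> \<bar>(x - p) \<bullet> n\<bar> = r \<Longrightarrow> x \<in> Z"
  shows "p \<in> inside Z"
proof -
  let ?O = "{x. - l1 < (x - p) \<bullet> e \<and> (x - p) \<bullet> e < l2 \<and> - r < (x - p) \<bullet> n \<and> (x - p) \<bullet> n < r}"
  have "closed Q"
    unfolding Q by (intro closed_Collect_conj closed_Collect_le continuous_intros)
  have "open ?O"
    by (intro open_Collect_conj open_Collect_less continuous_intros)
  then have O: "?O \<subseteq> interior Q" by (intro interior_maximal) (auto simp: Q)
  have fr: "frontier Q \<subseteq> Z"
  proof
    fix x assume "x \<in> frontier Q"
    then have x: "x \<in> Q" "x \<notin> ?O" using O \<open>closed Q\<close> by (auto simp: frontier_def)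
    then show "x \<in> Z" by (intro edges) (auto simp: Q)
  qed
  let ?V = "connected_component_set (- Z) p"
  have "p \<in> ?O" using l by simp
  then have pQ: "p \<in> Q" using O interior_subset[of Q] by blast
  have "?V \<subseteq> Q"
  proof (rule ccontr)
    assume "\<not> ?V \<subseteq> Q"
    then have "?V - Q \<noteq> {}" by blast
    moreover have "p \<in> ?V" using p by (simp add: connected_component_refl)
    then have "?V \<inter> Q \<noteq> {}" using pQ by blast
    ultimately have "?V \<inter> frontier Q \<noteq> {}"
      by (intro connected_Int_frontier connected_connected_component)
    then show False using fr connected_component_subset[of "- Z" p] by blast
  qed
  then show ?thesis using p \<open>bounded Q\<close> bounded_subset by (auto simp: inside_def)
qed

text \<open>If \<open>p\<close> were connected to infinity off \<open>A \<union> B1\<close> and off \<open>A \<union> B2\<close>, then Janiszewski's theorem, whose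
hypothesis is that the intersection \<open>A\<close> of these two sets is connected, would connect \<open>p\<close> to infinity
off their union.\<close>

lemma inside_one_of_two:
  fixes A B1 B2 :: "(real^2) set"
  assumes A: "compact A" "connected A" and B: "compact B1" "compact B2" "B1 \<inter> B2 = {}"
    and p: "p \<in> inside (A \<union> B1 \<union> B2)"
  shows "p \<in> inside (A \<union> B1) \<or> p \<in> inside (A \<union> B2)"
proof (rule ccontr)
  assume neg: "\<not> ?thesis"
  have pZ: "p \<notin> A \<union> B1 \<union> B2" using p by (simp add: inside_def)
  have K: "compact (A \<union> B1)" "compact (A \<union> B2)" "compact (A \<union> B1 \<union> B2)"
    using A B by auto
  have p1: "p \<in> outside (A \<union> B1)" "p \<in> outside (A \<union> B2)"
    using neg pZ by (auto simp: inside_def outside_def)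
  obtain B where B0: "A \<union> B1 \<union> B2 \<subseteq> ball 0 B" "0 < B"
    using bounded_subset_ballD[OF compact_imp_bounded[OF K(3)], of 0] by blast
  obtain b :: "real^2" where b: "norm b = B" using B0(2) by (meson less_imp_le vector_choose_size)
  have bo: "b \<in> outside S" if "S \<subseteq> A \<union> B1 \<union> B2" for S
  proof -
    have "S \<subseteq> ball 0 B" using that B0(1) by blast
    then have "- ball 0 B \<subseteq> outside S" by (intro outside_subset_convex) auto
    moreover have "b \<in> - ball 0 B" using b by simp
    ultimately show ?thesis by blast
  qed
  have conn: "connected_component (- S) p b" if "bounded S" "p \<in> outside S" "S \<subseteq> A \<union> B1 \<union> B2" for S
    unfolding connected_component_def
    using connected_outside[OF that(1)] that bo[OF that(3)]
    by (intro exI[of _ "outside S"]) (auto simp: outside_def)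
  have "(A \<union> B1) \<inter> (A \<union> B2) = A" using B(3) by blast
  then have "connected_component (- ((A \<union> B1) \<union> (A \<union> B2))) p b"
    using A K p1 by (intro Janiszewski_real2 conn compact_imp_bounded) auto
  moreover have "(A \<union> B1) \<union> (A \<union> B2) = A \<union> B1 \<union> B2" by blast
  ultimately have "b \<in> inside (A \<union> B1 \<union> B2)"
    using inside_same_component[OF _ p] by simp
  then show False using bo[of "A \<union> B1 \<union> B2"] inside_Int_outside[of "A \<union> B1 \<union> B2"] by blast
qed

text \<open>Let \<open>p\<close> be between \<open>q1\<close> and \<open>q2\<close> in \<open>S\<close>, with a margin \<open>r\<close> around both points. The compact set
consists of a path in \<open>S\<close> from \<open>q1\<close> to \<open>q2\<close> and the discs of radius \<open>r\<close> around its ends. Two large discs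
at distance \<open>r / 2\<close> from \<open>p\<close>, with centres on the normal through \<open>p\<close>, are flat enough to cover the sides
at height \<open>\<plusminus>r\<close> of the rectangle over \<open>q1 q2\<close>, whose other sides lie in the small discs.\<close>

lemma enclosed_by_disc:
  fixes S :: "(real^2) set"
  assumes S: "open S" "connected S" and p: "p \<in> convex hull S" "p \<notin> S"
  obtains A c R where "compact A" "A \<subseteq> S" "0 \<le> R" "R < dist c p" "p \<in> inside (A \<union> cball c R)"
proof -
  obtain q1 q2 where q: "q1 \<in> S" "q2 \<in> S" "p \<in> closed_segment q1 q2"
    using connected_hull_two_points[OF S(2) p(1)] by blast
  have ne: "q1 \<noteq> p" "q2 \<noteq> p" using q p by auto
  obtain k where k: "0 \<le> k" "k \<le> 1" "p = (1 - k) *\<^sub>R q1 + k *\<^sub>R q2"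
    using q(3) by (auto simp: in_segment)
  have k01: "0 < k" "k < 1" using k ne by (auto simp: order_le_less)
  define L where "L = norm (q2 - q1)"
  have L: "L > 0" using q p by (auto simp: L_def)
  define e where "e = (1 / L) *\<^sub>R (q2 - q1)"
  have e: "norm e = 1" using L by (simp add: e_def L_def)
  then have ee: "e \<bullet> e = 1" by (simp add: norm_eq_1)
  obtain n where n: "n \<bullet> n = 1" "n \<bullet> e = 0" "\<And>y. y = (y \<bullet> e) *\<^sub>R e + (y \<bullet> n) *\<^sub>R n"
    "\<And>y. (norm y)\<^sup>2 = (y \<bullet> e)\<^sup>2 + (y \<bullet> n)\<^sup>2" using plane_frame[OF e] by metis
  define l1 where "l1 = k * L"
  define l2 where "l2 = (1 - k) * L"
  have l: "l1 > 0" "l2 > 0" using k01 L by (auto simp: l1_def l2_def)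
  have Le: "L *\<^sub>R e = q2 - q1" using L by (simp add: e_def)
  have q1: "q1 = p - l1 *\<^sub>R e" 
    unfolding l1_def scaleR_scaleR[symmetric] Le k(3) by (simp add: algebra_simps)
  have q2: "q2 = p + l2 *\<^sub>R e"
    unfolding l2_def scaleR_scaleR[symmetric] Le k(3) by (simp add: algebra_simps)
  obtain r1 where r1: "r1 > 0" "cball q1 r1 \<subseteq> S" using S(1) q(1) open_contains_cball by blast
  obtain r2 where r2: "r2 > 0" "cball q2 r2 \<subseteq> S" using S(1) q(2) open_contains_cball by blast
  define r where "r = min r1 r2"
  have r: "r > 0" "cball q1 r \<subseteq> S" "cball q2 r \<subseteq> S" using r1 r2 by (auto simp: r_def)
  have "path_connected S" using S by (simp add: connected_open_path_connected)
  then obtain g where g: "path g" "path_image g \<subseteq> S" "pathstart g = q1" "pathfinish g = q2"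
    using q(1,2) unfolding path_connected_def by blast
  define A where "A = path_image g \<union> (cball q1 r \<union> cball q2 r)"
  have A: "compact A" "A \<subseteq> S"
    using g(1,2) r(2,3) unfolding A_def
    by (intro compact_Un compact_path_image compact_cball, simp, intro Un_least)
  have qg: "q1 \<in> path_image g" "q2 \<in> path_image g"
    using g pathstart_in_path_image pathfinish_in_path_image by metis+
  have connA: "connected A"
  proof -
    have "connected (path_image g \<union> cball q1 r)"
      by (rule connected_Un) (use g qg r in \<open>auto simp: connected_path_image\<close>)
    then have "connected ((path_image g \<union> cball q1 r) \<union> cball q2 r)"
      by (rule connected_Un) (use qg r in auto)
    then show ?thesis by (simp add: A_def Un_assoc)
  qed
  define l where "l = l1 + l2"
  \<comment> \<open>The distance \<open>h\<close> of the centres from \<open>p\<close> and the radius \<open>R = h - r / 2\<close> are such that the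
    chord of the disc at distance \<open>h - r\<close> from its centre has half-length at least \<open>l\<close>; see \<open>key\<close>.\<close>
  define h where "h = l\<^sup>2 / r + r"
  define R where "R = h - r / 2"
  have hr: "h * r = l\<^sup>2 + r\<^sup>2" using r by (simp add: h_def field_simps power2_eq_square)
  have h: "h \<ge> r" using r by (simp add: h_def)
  have R0: "0 \<le> R" "R < h" using h r by (auto simp: R_def)
  have key: "X\<^sup>2 + (h - r)\<^sup>2 \<le> R\<^sup>2" if "\<bar>X\<bar> \<le> l" for X
  proof -
    have "X\<^sup>2 \<le> l\<^sup>2" using that by (metis abs_le_square_iff abs_of_nonneg abs_ge_zero order_trans)
    moreover have "R\<^sup>2 - (h - r)\<^sup>2 = h * r - 3 * r\<^sup>2 / 4"
      by (simp add: R_def power2_eq_square algebra_simps)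
    moreover have "r\<^sup>2 \<ge> 0" by simp
    ultimately show ?thesis using hr by linarith
  qed
  define c1 where "c1 = p + h *\<^sub>R n"
  define c2 where "c2 = p - h *\<^sub>R n"
  have nn: "norm n = 1" using n by (simp add: norm_eq_1)
  have dp: "dist c1 p = h" "dist c2 p = h" using h r by (auto simp: c1_def c2_def dist_norm nn)
  define Q where "Q = {x. - l1 \<le> (x - p) \<bullet> e \<and> (x - p) \<bullet> e \<le> l2 \<and> - r \<le> (x - p) \<bullet> n \<and> (x - p) \<bullet> n \<le> r}"
  let ?Z = "A \<union> cball c1 R \<union> cball c2 R"
  have coords: "(dist y x)\<^sup>2 = ((x - p) \<bullet> e - (y - p) \<bullet> e)\<^sup>2 + ((x - p) \<bullet> n - (y - p) \<bullet> n)\<^sup>2" for x y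
  proof -
    have "(dist y x)\<^sup>2 = (norm (x - y))\<^sup>2" by (simp add: dist_norm norm_minus_commute)
    also have "\<dots> = ((x - y) \<bullet> e)\<^sup>2 + ((x - y) \<bullet> n)\<^sup>2" by (rule n(4))
    finally show ?thesis by (simp add: inner_diff_left)
  qed
  have in_cball: "x \<in> cball y s" if "(dist y x)\<^sup>2 \<le> s\<^sup>2" "0 \<le> s" for x y :: "real^2" and s
    using power2_le_imp_le[OF that] by simp
  have ne': "e \<bullet> n = 0" using n(2) by (simp add: inner_commute)
  have "p \<in> inside ?Z"
  proof (rule rectangle_inside[OF _ _ l r(1) Q_def])
    show "closed ?Z" using A(1) by (intro closed_Un compact_imp_closed closed_cball)
    show "p \<notin> ?Z" using A p(2) dp R0 by auto
    show "bounded Q"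
    proof -
      have "dist p x \<le> l + r" if x: "x \<in> Q" for x
      proof -
        have "\<bar>(x - p) \<bullet> e\<bar> \<le> l" "\<bar>(x - p) \<bullet> n\<bar> \<le> r" using x l by (auto simp: Q_def l_def)
        moreover have "norm (x - p) \<le> norm (((x - p) \<bullet> e) *\<^sub>R e) + norm (((x - p) \<bullet> n) *\<^sub>R n)"
          using norm_triangle_ineq n(3)[of "x - p"] by metis
        ultimately show ?thesis using e nn by (simp add: dist_norm norm_minus_commute)
      qed
      then show ?thesis unfolding bounded_def by blast
    qed
    fix x assume x: "x \<in> Q"
      and edge: "(x - p) \<bullet> e = - l1 \<or> (x - p) \<bullet> e = l2 \<or> \<bar>(x - p) \<bullet> n\<bar> = r"
    have X: "\<bar>(x - p) \<bullet> e\<bar> \<le> l" using x l by (auto simp: Q_def l_def)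
    have Y: "((x - p) \<bullet> n)\<^sup>2 \<le> r\<^sup>2"
      using x r(1) by (intro abs_le_square_iff[THEN iffD1]) (auto simp: Q_def)
    from edge consider "(x - p) \<bullet> e = - l1" | "(x - p) \<bullet> e = l2" | "(x - p) \<bullet> n = r" | "(x - p) \<bullet> n = - r"
      by linarith
    then show "x \<in> ?Z"
    proof cases
      case 1
      have "(dist q1 x)\<^sup>2 \<le> r\<^sup>2"
        unfolding coords using 1 Y by (simp add: q1 ee ne')
      then show ?thesis using in_cball[of q1 x r] r by (simp add: A_def)
    next
      case 2
      have "(dist q2 x)\<^sup>2 \<le> r\<^sup>2"
        unfolding coords using 2 Y by (simp add: q2 ee ne')
      then show ?thesis using in_cball[of q2 x r] r by (simp add: A_def)
    next
      case 3
      have "(dist c1 x)\<^sup>2 \<le> R\<^sup>2"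
        unfolding coords using 3 key[OF X] by (simp add: c1_def n(1,2) power2_commute[of r h])
      then show ?thesis using in_cball[of c1 x R] R0 by simp
    next
      case 4
      have "(dist c2 x)\<^sup>2 \<le> R\<^sup>2"
        unfolding coords using 4 key[OF X] by (simp add: c2_def n(1,2))
      then show ?thesis using in_cball[of c2 x R] R0 by simp
    qed
  qed
  moreover have "cball c1 R \<inter> cball c2 R = {}"
  proof -
    have "c1 - c2 = (2 * h) *\<^sub>R n" by (simp add: c1_def c2_def scaleR_2 flip: scaleR_scaleR)
    then have "dist c1 c2 = 2 * h" using h r by (simp add: dist_norm nn)
    then show ?thesis using R0 by (intro disjoint_cballI) linarith
  qed
  ultimately have "p \<in> inside (A \<union> cball c1 R) \<or> p \<in> inside (A \<union> cball c2 R)"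
    using A connA by (intro inside_one_of_two) auto
  then show ?thesis using that[OF A R0(1)] dp R0(2) by metis
qed

section \<open>Points of the hull are reached\<close>

text \<open>In the bounded component of \<open>p\<close> off \<open>A\<close> and the disc, \<open>-u\<close> is a subflow whose boundary values are
controlled on \<open>A\<close>, and the rest of the boundary lies in the disc. For \<open>T > \<tau>\<close> the shrinking circle
that arrives at the radius \<open>R\<close> at time \<open>T\<close> initially contains the whole component, so there is no
condition on the initial values.\<close>

lemma hull_point_reached:
  fixes S :: "(real^2) set"
  assumes sol: "obstacle_solution 0 \<Psi>m \<Psi>p u0 u" and G: "level_range G" and \<Psi>p: "\<And>x. \<Psi>p x \<in> G"
    and S: "open S" "connected S" "\<And>x t. x \<in> S \<Longrightarrow> 0 \<le> t \<Longrightarrow> u (x, t) \<in> G"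
    and p: "p \<in> convex hull S"
  shows "\<exists>\<tau>>0. \<forall>t>\<tau>. u (p, t) \<in> G"
proof (cases "p \<in> S")
  case True
  then show ?thesis using S(3) by (intro exI[of _ 1]) auto
next
  case False
  note cont = obstacle_solutionD(1)[OF sol]
  obtain A c R where A: "compact A" "A \<subseteq> S" and R: "0 \<le> R" "R < dist c p"
    and ins: "p \<in> inside (A \<union> cball c R)"
    using enclosed_by_disc[OF S(1,2) p False] by metis
  let ?Z = "A \<union> cball c R"
  let ?V = "connected_component_set (- ?Z) p"
  define C where "C = closure ?V"
  have pZ: "p \<notin> ?Z" and bdd: "bounded ?V" using ins by (auto simp: inside_def)
  have closedZ: "closed ?Z" using A(1) by (intro closed_Un compact_imp_closed closed_cball)
  have C: "compact C" using bdd by (simp add: C_def compact_closure)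
  have pC: "p \<in> C" unfolding C_def using pZ closure_subset[of ?V] by (auto simp: connected_component_refl)
  have "open ?V" by (intro open_connected_component open_Compl closedZ)
  then have "?V \<subseteq> interior C" unfolding C_def by (intro interior_maximal closure_subset)
  then have "C - interior C \<subseteq> frontier ?V"
    using \<open>open ?V\<close> by (auto simp: frontier_def C_def interior_open)
  also have "\<dots> \<subseteq> frontier (- ?Z)" by (rule frontier_of_connected_component_subset)
  also have "\<dots> \<subseteq> ?Z" unfolding frontier_complement by (rule frontier_subset_closed[OF closedZ])
  finally have bd: "C - interior C \<subseteq> ?Z" .
  obtain B where B: "\<And>x. x \<in> C \<Longrightarrow> dist c x \<le> B"
    using compact_imp_bounded[OF C] bounded_any_center[of C c] by auto
  define \<tau> where "\<tau> = B\<^sup>2 + 1"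
  have "u (p, T) \<in> G" if T: "T > \<tau>" for T
  proof -
    have T0: "0 \<le> T" using T unfolding \<tau>_def by (smt (verit) zero_le_power2)
    have "compact (A \<times> {0..T+1})" using A by (intro compact_Times) auto
    then obtain \<delta>1 where \<delta>1: "\<delta>1 \<in> G" "\<And>z. z \<in> A \<times> {0..T+1} \<Longrightarrow> \<delta>1 \<le> u z"
      by (rule level_compact_lower[OF G _ continuous_on_window[OF cont]]) (use S(3) A in auto)
    obtain \<delta>2 where \<delta>2: "\<delta>2 \<in> G" "\<And>z. z \<in> C \<Longrightarrow> \<delta>2 \<le> \<Psi>p z"
      by (rule level_compact_lower[OF G C obstacle_solutionD(3)[OF sol]]) (use \<Psi>p in auto)
    define \<delta> where "\<delta> = min \<delta>1 \<delta>2"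
    have \<delta>: "\<delta> \<in> G" using \<delta>1(1) \<delta>2(1) by (simp add: \<delta>_def min_def)
    have "- u (p, T) \<le> - \<delta>"
    proof (rule subflow_confined_to_disc[OF C T0 _ _ _ _ pC R(2,1)])
      show "continuous_on (C \<times> {0..T + 1}) (\<lambda>z. - u z)"
        by (intro continuous_on_minus continuous_on_window cont)
      show "curvature_subflow (- \<delta>) C (\<lambda>z. - u z)"
        using \<delta>2(2) by (intro obstacle_solutionD(5)[OF sol]) (force simp: \<delta>_def)
      show "\<forall>t\<in>{0..T + 1}. - u (x, t) \<le> - \<delta>"
        if "x \<in> C" "x \<notin> interior C" "R < dist c x" for x
      proof -
        have "x \<in> A" using bd that by auto
        then show ?thesis using \<delta>1(2) by (auto simp: \<delta>_def min_le_iff_disj)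
      qed
      show "- u (x, 0) \<le> - \<delta>" if x: "x \<in> C" "R\<^sup>2 + 2 * T \<le> (dist c x)\<^sup>2" for x
      proof -
        have "(dist c x)\<^sup>2 \<le> B\<^sup>2" using B[OF x(1)] by (intro power_mono) auto
        moreover have "0 \<le> R\<^sup>2" by simp
        ultimately have False using x(2) T T0 unfolding \<tau>_def by linarith
        then show ?thesis ..
      qed
    qed
    then show ?thesis using level_range_mono[OF G \<delta>] by simp
  qed
  moreover have "\<tau> > 0" by (simp add: \<tau>_def add_nonneg_pos)
  ultimately show ?thesis by blast
qed

section \<open>The network of segments\<close>

text \<open>The choice \<open>x = y\<close> includes the points of \<open>Om\<close>.\<close>

definition bridged :: "'a::real_vector set \<Rightarrow> 'a set \<Rightarrow> 'a set" where
  "bridged Om D0 = \<Union> {closed_segment x y | x y. x \<in> Om \<and> y \<in> Om \<and> closed_segment x y \<subseteq> D0}"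

lemma subset_bridged: "Om \<subseteq> D0 \<Longrightarrow> Om \<subseteq> bridged Om D0"
  unfolding bridged_def by (force intro: exI[where x="closed_segment x x" for x])

text \<open>A short translation of an admissible segment is again admissible.\<close>

lemma open_bridged:
  fixes Om D0 :: "'a::euclidean_space set"
  assumes "open Om" "open D0"
  shows "open (bridged Om D0)"
  unfolding open_dist
proof
  fix z assume "z \<in> bridged Om D0"
  then obtain x y where xy: "x \<in> Om" "y \<in> Om" "closed_segment x y \<subseteq> D0" "z \<in> closed_segment x y"
    by (auto simp: bridged_def)
  obtain r1 where r1: "r1 > 0" "ball x r1 \<subseteq> Om" using assms(1) xy(1) open_contains_ball by blast
  obtain r2 where r2: "r2 > 0" "ball y r2 \<subseteq> Om" using assms(1) xy(2) open_contains_ball by blast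
  obtain r3 where r3: "r3 > 0" "(\<Union>z\<in>closed_segment x y. cball z r3) \<subseteq> D0"
    using compact_subset_open_imp_cball_epsilon_subset[OF compact_segment assms(2) xy(3)] by blast
  define r where "r = min r1 (min r2 r3)"
  have "z' \<in> bridged Om D0" if z': "dist z' z < r" for z'
  proof -
    define d where "d = z' - z"
    have d: "norm d < r" using z' by (simp add: d_def dist_norm)
    have tr: "closed_segment (d + x) (d + y) = (\<lambda>v. d + v) ` closed_segment x y"
      by (rule closed_segment_translation)
    have "d + x \<in> ball x r1" "d + y \<in> ball y r2"
      using d by (auto simp: dist_norm r_def)
    moreover have "closed_segment (d + x) (d + y) \<subseteq> D0"
    proof
      fix w assume "w \<in> closed_segment (d + x) (d + y)"
      then obtain v where v: "v \<in> closed_segment x y" "w = d + v" unfolding tr by blast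
      then have "w \<in> cball v r3" using d by (simp add: dist_norm r_def)
      then show "w \<in> D0" using r3(2) v(1) by blast
    qed
    moreover have "z' \<in> closed_segment (d + x) (d + y)"
      unfolding tr using xy(4) by (rule rev_image_eqI) (simp add: d_def)
    ultimately show ?thesis using r1 r2 unfolding bridged_def by blast
  qed
  moreover have "r > 0" using r1 r2 r3 by (simp add: r_def)
  ultimately show "\<exists>e>0. \<forall>y. dist y z < e \<longrightarrow> y \<in> bridged Om D0" by blast
qed

text \<open>A walk in the component graph is turned into a chain of connected sets: the components that it
visits, and for each edge a segment that joins two of them.\<close>

lemma connected_bridged:
  fixes Om D0 :: "'a::euclidean_space set"
  assumes "Om \<subseteq> D0" and graph: "connected_graph (component_graph Om D0)"
  shows "connected (bridged Om D0)"
proof -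
  let ?S = "bridged Om D0"
  let ?cc = "connected_component ?S"
  have OmS: "Om \<subseteq> ?S" by (rule subset_bridged[OF assms(1)])
  have conn: "?cc a b" if "connected T" "T \<subseteq> ?S" "a \<in> T" "b \<in> T" for a b T
    using that by (auto simp: connected_component_def)
  have comp: "?cc a b" if "A \<in> components Om" "a \<in> A" "b \<in> A" for a b A
    using that OmS by (intro conn[of A]) (auto dest: in_components_connected in_components_subset)
  have seg: "?cc a b" if "x \<in> Om" "y \<in> Om" "closed_segment x y \<subseteq> D0"
      "a \<in> closed_segment x y" "b \<in> closed_segment x y" for x y a b
    using that by (intro conn[of "closed_segment x y"]) (auto simp: bridged_def)
  have adj: "?cc a b" if AB: "Upair A B \<in> snd (component_graph Om D0)" "a \<in> A" "b \<in> B" for A B a b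
  proof -
    obtain A' B' x y where AB': "Upair A B = Upair A' B'" "A' \<in> components Om" "B' \<in> components Om"
      "x \<in> A'" "y \<in> B'" "closed_segment x y \<subseteq> D0"
      using AB(1) by (auto simp: component_graph_def)
    have xy: "x \<in> Om" "y \<in> Om" using AB' in_components_subset by blast+
    have s: "?cc x y" using seg[OF xy AB'(6)] by simp
    from AB'(1) consider "A = A'" "B = B'" | "A = B'" "B = A'" by auto
    then show ?thesis
    proof cases
      case 1
      then have "?cc a x" "?cc y b" using comp AB' AB by auto
      then show ?thesis using s connected_component_trans by metis
    next
      case 2
      then have "?cc a y" "?cc x b" using comp AB' AB by auto
      then show ?thesis using s connected_component_trans connected_component_sym by metis
    qed
  qed
  have walk: "\<forall>A\<in>components Om. \<forall>B\<in>components Om. \<exists>m (X :: nat \<Rightarrow> 'a set). X 0 = A \<and> X m = B \<and>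
      (\<forall>i\<le>m. X i \<in> components Om) \<and>
      (\<forall>i<m. Upair (X i) (X (Suc i)) \<in> snd (component_graph Om D0))"
    using graph unfolding connected_graph_def component_graph_def by simp
  have OmOm: "?cc a b" if ab: "a \<in> Om" "b \<in> Om" for a b
  proof -
    obtain A B where A: "A \<in> components Om" "a \<in> A" and B: "B \<in> components Om" "b \<in> B"
      using ab Union_components[of Om] by blast
    obtain m X where X: "X 0 = A" "X m = B" "\<And>i. i \<le> m \<Longrightarrow> X i \<in> components Om"
      "\<And>i. i < m \<Longrightarrow> Upair (X i) (X (Suc i)) \<in> snd (component_graph Om D0)"
      using walk[rule_format, OF A(1) B(1)] by blast
    have "\<forall>x\<in>X i. ?cc a x" if "i \<le> m" for i
      using that
    proof (induction i)
      case 0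
      then show ?case using X(1) A comp by auto
    next
      case (Suc i)
      then obtain y where y: "y \<in> X i" using X(3)[of i] in_components_nonempty by fastforce
      then have "?cc a y" using Suc by simp
      then show ?case using adj[OF X(4)[of i] y] Suc.prems connected_component_trans
        by (metis Suc_le_lessD)
    qed
    then show ?thesis using X(2) B(2) by blast
  qed
  have "?cc a b" if ab: "a \<in> ?S" "b \<in> ?S" for a b
  proof -
    obtain x y where x: "x \<in> Om" "y \<in> Om" "closed_segment x y \<subseteq> D0" "a \<in> closed_segment x y"
      using ab(1) by (auto simp: bridged_def)
    obtain x' y' where x': "x' \<in> Om" "y' \<in> Om" "closed_segment x' y' \<subseteq> D0" "b \<in> closed_segment x' y'"
      using ab(2) by (auto simp: bridged_def)
    have "?cc a x" "?cc x' b" using seg[OF x(1-3)] seg[OF x'(1-3)] x(4) x'(4) by auto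
    then show ?thesis using OmOm[OF x(1) x'(1)] connected_component_trans by metis
  qed
  then show ?thesis by (simp add: connected_iff_connected_component)
qed

section \<open>The limits of the evolutions\<close>

lemma evolution_limits:
  fixes Om D0 :: "(real^2) set"
  assumes sol: "obstacle_solution 0 \<Psi>m \<Psi>p u0 u" and G: "level_range G" and \<Psi>p: "\<And>x. \<Psi>p x \<in> G"
    and \<Psi>m: "{x. \<Psi>m x \<in> G} \<subseteq> closure Om"
    and F: "\<And>t. 0 \<le> t \<Longrightarrow> F t = {x. u (x, t) \<in> G}" "\<And>t. 0 \<le> t \<Longrightarrow> Om \<subseteq> F t"
      "D0 \<subseteq> F 0" "bounded (F 0)"
    and Om: "open Om" "open D0" "Om \<subseteq> D0" "bounded D0"
    and graph: "connected_graph (component_graph Om D0)"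
  shows "convex hull Om \<subseteq> lower_limit F \<and> lower_limit F \<subseteq> upper_limit F \<and>
    upper_limit F \<subseteq> closure (convex hull Om)"
proof (intro conjI)
  let ?S = "bridged Om D0"
  have stay: "u (x, t) \<in> G" if x: "x \<in> ?S" and t: "0 \<le> t" for x t
  proof -
    obtain a b where ab: "a \<in> Om" "b \<in> Om" "closed_segment a b \<subseteq> D0" "x \<in> closed_segment a b"
      using x by (auto simp: bridged_def)
    show ?thesis
    proof (rule segment_persists[OF sol G \<Psi>p Om(1) _ Om(2) _ ab t])
      show "u (y, s) \<in> G" if "y \<in> Om" "0 \<le> s" for y s
        using F(1,2)[OF that(2)] that(1) by blast
      show "u (y, 0) \<in> G" if "y \<in> D0" for y
        using F(1)[of 0] F(3) that by blast
    qed
  qed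
  show "convex hull Om \<subseteq> lower_limit F"
  proof
    fix p assume "p \<in> convex hull Om"
    then have "p \<in> convex hull ?S" using hull_mono[OF subset_bridged[OF Om(3)]] by blast
    then have "\<exists>\<tau>>0. \<forall>t>\<tau>. u (p, t) \<in> G"
      by (rule hull_point_reached[OF sol G \<Psi>p open_bridged[OF Om(1,2)]
            connected_bridged[OF Om(3) graph], rotated]) (rule stay)
    then obtain \<tau> where \<tau>: "\<tau> > 0" "\<forall>t>\<tau>. u (p, t) \<in> G" by blast
    have "p \<in> F t" if "t > \<tau>" for t
      using F(1)[of t] \<tau> that by simp
    then show "p \<in> lower_limit F"
      using \<tau>(1) unfolding lower_limit_def by blast
  qed
  show "lower_limit F \<subseteq> upper_limit F"
  proof
    fix x assume "x \<in> lower_limit F"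
    then obtain s where s: "\<And>t. t > s \<Longrightarrow> x \<in> F t" unfolding lower_limit_def by blast
    have "\<exists>t>\<tau>. x \<in> F t" for \<tau>
      using s[of "max s \<tau> + 1"] by (intro exI[of _ "max s \<tau> + 1"]) auto
    then show "x \<in> upper_limit F" unfolding upper_limit_def by auto
  qed
  have "components Om \<noteq> {}"
    using graph by (auto simp: connected_graph_def component_graph_def is_graph_def)
  then have "Om \<noteq> {}" by auto
  have "bounded (convex hull Om)" using Om bounded_subset bounded_convex_hull by metis
  show "upper_limit F \<subseteq> closure (convex hull Om)"
  proof (rule upper_limit_subset_hull[OF sol G F(1)])
    show "{x. \<Psi>m x \<in> G} \<subseteq> closure (convex hull Om)"
      using \<Psi>m closure_mono[OF hull_subset[of Om convex]] by blast
    show "bounded (closure (convex hull Om))"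
      using \<open>bounded (convex hull Om)\<close> by (rule bounded_closure)
  qed (use \<open>Om \<noteq> {}\<close> F(4) in \<open>simp_all add: convex_closure convex_convex_hull\<close>)
qed

theorem theorem3p2:
  fixes Om D0 :: "(real^2) set" and D E :: "real \<Rightarrow> (real^2) set"
  assumes "open Om" and "open D0" and "Om \<subseteq> D0" and "bounded D0"
    and "open_evolution 0 D0 Om UNIV D"
    and "closed_evolution 0 (closure D0) (closure Om) UNIV E"
    and "connected_graph (component_graph Om D0)"
  shows "(convex hull Om \<subseteq> lower_limit D \<and> lower_limit D \<subseteq> upper_limit D \<and>
          upper_limit D \<subseteq> closure (convex hull Om)) \<and>
         (convex hull Om \<subseteq> lower_limit E \<and> lower_limit E \<subseteq> upper_limit E \<and>
          upper_limit E \<subseteq> closure (convex hull Om))"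
proof (rule conjI)
  note graph = assms(1-4,7)
  obtain \<Psi>m \<Psi>p u0 u where sol: "obstacle_solution 0 \<Psi>m \<Psi>p u0 u"
    "Om = {x. \<Psi>m x > 0}" "UNIV = {x. \<Psi>p x > 0}" "\<forall>t\<ge>0. D t = {x. u (x, t) > 0}"
    using assms(5) unfolding open_evolution_def by blast
  have D: "D 0 = D0" "\<And>t. 0 \<le> t \<Longrightarrow> Om \<subseteq> D t"
    using assms(5) unfolding open_evolution_def by auto
  show "convex hull Om \<subseteq> lower_limit D \<and> lower_limit D \<subseteq> upper_limit D \<and>
      upper_limit D \<subseteq> closure (convex hull Om)"
  proof (rule evolution_limits[OF sol(1), where G="{0<..}"])
    show "\<Psi>p x \<in> {0<..}" for x
      using UNIV_I[of x] unfolding sol(3) by simp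
    show "{x. \<Psi>m x \<in> {0<..}} \<subseteq> closure Om"
      using closure_subset[of Om] sol(2) by simp
    show "D t = {x. u (x, t) \<in> {0<..}}" if "0 \<le> t" for t
      using sol(4) that by simp
    show "bounded (D 0)" using D(1) assms(4) by simp
  qed (use D graph in \<open>simp_all add: level_range_def\<close>)
  obtain \<Phi>m \<Phi>p v0 v where sol': "obstacle_solution 0 \<Phi>m \<Phi>p v0 v"
    "closure Om = {x. \<Phi>m x \<ge> 0}" "UNIV = {x. \<Phi>p x \<ge> 0}" "\<forall>t\<ge>0. E t = {x. v (x, t) \<ge> 0}"
    using assms(6) unfolding closed_evolution_def by blast
  have E: "E 0 = closure D0" "\<And>t. 0 \<le> t \<Longrightarrow> closure Om \<subseteq> E t"
    using assms(6) unfolding closed_evolution_def by auto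
  show "convex hull Om \<subseteq> lower_limit E \<and> lower_limit E \<subseteq> upper_limit E \<and>
      upper_limit E \<subseteq> closure (convex hull Om)"
  proof (rule evolution_limits[OF sol'(1), where G="{0..}"])
    show "\<Phi>p x \<in> {0..}" for x
      using UNIV_I[of x] unfolding sol'(3) by simp
    show "{x. \<Phi>m x \<in> {0..}} \<subseteq> closure Om"
      using sol'(2) by simp
    show "E t = {x. v (x, t) \<in> {0..}}" if "0 \<le> t" for t
      using sol'(4) that by simp
    show "Om \<subseteq> E t" if "0 \<le> t" for t
      using closure_subset[of Om] E(2)[OF that] by blast
    show "D0 \<subseteq> E 0" "bounded (E 0)"
      using E(1) closure_subset[of D0] assms(4) by (simp_all add: bounded_closure)
  qed (use graph in \<open>simp_all add: level_range_def\<close>)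
qed

end
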